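(* For every integer $r\ge 1$ and every real $k>0$ there is a set $S$ of rational primes such that $$\mathsf M_S(N)\sim k(\log\log N)^{r}\qquad (N\to\infty).$$
   Context: $\mathbb P$ is the set of rational primes and $|\cdot|_p$ is the $p$-adic absolute value on $\mathbb Q$ with $|p|_p=p^{-1}$. For $S\subseteq\mathbb P$ let $R_S=\{r\in\mathbb Q: |r|_p\le 1\text{ for all }p\in\mathbb P\setminus S\}$, and let $T_S$ be the continuous endomorphism of the compact dual group $\widehat{R_S}$ dual to $r\mapsto 2r$ on the discrete group $R_S$. A closed orbit $\tau$ of length $|\tau|=n$ is a set $\{x,T_S(x),\dots,T_S^n(x)=x\}$ of cardinality $n$. Define $\mathsf M_S(N)=\sum_{|\tau|\le N}e^{-h|\tau|}$, the sum over closed orbits of $T_S$ of length at most $N$, where $h=h(T_S)$ is the topological entropy. It is known that $h(T_S)=\log 2$ and that the number of points with $T_S^nx=x$ is $(2^n-1)\prod_{p\in S}|2^n-1|_p$, so that, with $|x|_S=\prod_{p\in S}|x|_p$ and $\mu$ the Möbius function, $$\mathsf M_S(N)=\sum_{n\le N}\frac1{n2^n}\sum_{d\mid n}\mu(n/d)\,(2^d-1)\,|2^d-1|_S .$$ *)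

theory Defs
  imports "HOL-Analysis.Analysis" "HOL-Library.Landau_Symbols"
    "HOL-Computational_Algebra.Primes"
begin

definition padic_abs :: "nat \<Rightarrow> rat \<Rightarrow> real" where
  "padic_abs p r =
     (if r = 0 then 0
      else case quotient_of r of (a, b) \<Rightarrow>
        real p powi (int (multiplicity (int p) b) - int (multiplicity (int p) a)))"

definition RS :: "nat set \<Rightarrow> rat set" where
  "RS S = {r. \<forall>p. prime p \<and> p \<notin> S \<longrightarrow> padic_abs p r \<le> 1}"

text \<open>Characters of the additive group \<open>RS S\<close>, represented as functions that are
  \<open>undefined\<close> outside \<open>RS S\<close>.\<close>

definition characters :: "nat set \<Rightarrow> (rat \<Rightarrow> complex) set" where
  "characters S =
     {f. f \<in> RS S \<rightarrow>\<^sub>E sphere 0 1 \<and> (\<forall>x\<in>RS S. \<forall>y\<in>RS S. f (x + y) = f x * f y)}"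

text \<open>As \<open>RS S\<close> is discrete, the compact-open topology on its dual is the topology of
  pointwise convergence.\<close>

definition dual_RS :: "nat set \<Rightarrow> (rat \<Rightarrow> complex) topology" where
  "dual_RS S = subtopology (product_topology (\<lambda>_. euclidean) (RS S)) (characters S)"

definition TS :: "nat set \<Rightarrow> (rat \<Rightarrow> complex) \<Rightarrow> (rat \<Rightarrow> complex)" where
  "TS S f = (\<lambda>r\<in>RS S. f (2 * r))"

text \<open>Topological entropy of a continuous self-map \<open>T\<close> of a compact space \<open>X\<close>, following
  Adler, Konheim and McAndrew: \<open>iter_join X T \<U> n\<close> is the join of the covers
  \<open>\<U>, T\<^sup>-\<^sup>1 \<U>, \<dots>, T\<^sup>-\<^sup>(\<^sup>n\<^sup>-\<^sup>1\<^sup>) \<U>\<close>, and \<open>cover_number X \<V>\<close> is the least cardinality of a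
  subcover of \<open>\<V>\<close>. The limit defining the entropy relative to a cover exists by
  subadditivity, so that taking the upper limit is harmless.\<close>

definition open_covers :: "'a topology \<Rightarrow> 'a set set set" where
  "open_covers X = {\<U>. (\<forall>U\<in>\<U>. openin X U) \<and> \<Union>\<U> = topspace X}"

definition cover_number :: "'a topology \<Rightarrow> 'a set set \<Rightarrow> nat" where
  "cover_number X \<V> =
     (LEAST m. \<exists>\<W>\<subseteq>\<V>. finite \<W> \<and> \<Union>\<W> = topspace X \<and> card \<W> = m)"

definition iter_join :: "'a topology \<Rightarrow> ('a \<Rightarrow> 'a) \<Rightarrow> 'a set set \<Rightarrow> nat \<Rightarrow> 'a set set" where
  "iter_join X T \<U> n =
     {{x \<in> topspace X. \<forall>i<n. (T ^^ i) x \<in> u i} |u. \<forall>i<n. u i \<in> \<U>}"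

definition cover_entropy :: "'a topology \<Rightarrow> ('a \<Rightarrow> 'a) \<Rightarrow> 'a set set \<Rightarrow> ereal" where
  "cover_entropy X T \<U> =
     limsup (\<lambda>n. ereal (ln (real (cover_number X (iter_join X T \<U> n))) / real n))"

definition topological_entropy :: "'a topology \<Rightarrow> ('a \<Rightarrow> 'a) \<Rightarrow> ereal" where
  "topological_entropy X T = (SUP \<U>\<in>open_covers X. cover_entropy X T \<U>)"

definition closed_orbits :: "'a topology \<Rightarrow> ('a \<Rightarrow> 'a) \<Rightarrow> nat \<Rightarrow> 'a set set" where
  "closed_orbits X T n =
     {\<tau>. \<exists>x\<in>topspace X. \<tau> = (\<lambda>i. (T ^^ i) x) ` {0..n} \<and> (T ^^ n) x = x \<and> card \<tau> = n}"

text \<open>The entropy of \<open>TS S\<close> is finite (it is \<open>ln 2\<close>) and \<open>TS S\<close> has only finitely many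
  closed orbits of each length, so neither \<open>real_of_ereal\<close> nor the sum takes its default
  value \<open>0\<close>.\<close>

definition MS :: "nat set \<Rightarrow> nat \<Rightarrow> real" where
  "MS S N =
     (\<Sum>\<tau> \<in> (\<Union>n\<le>N. closed_orbits (dual_RS S) (TS S) n).
        exp (- real_of_ereal (topological_entropy (dual_RS S) (TS S)) * real (card \<tau>)))"

end

theory Submission
  imports Defs "HOL-Number_Theory.Number_Theory" "HOL-Computational_Algebra.Squarefree"
    "HOL-Real_Asymp.Real_Asymp"
begin

text \<open>Call \<open>n\<close> admissible if it is squarefree with all prime factors in a set \<open>P\<close> of primes, and
  let \<open>S\<close> consist of the primes modulo which the order of \<open>2\<close> is not admissible. Divisors
  of admissible numbers are admissible, so for admissible \<open>n\<close> no prime of \<open>S\<close> divides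
  \<open>2\<^sup>n - 1\<close> and \<open>T\<^sup>n\<close> has \<open>2\<^sup>n - 1\<close> fixed points. If \<open>n\<close> is not admissible, there is a prime
  \<open>q\<close> dividing \<open>n\<close> such that the divisors of \<open>n\<close> which do not divide \<open>n / q\<close> are not admissible;
  then \<open>(2\<^sup>n - 1) / (2\<^sup>n\<^sup>/\<^sup>q - 1)\<close> has only prime factors in \<open>S\<close>, up to a factor \<open>q\<close>, which leaves at
  most \<open>n 2\<^sup>n\<^sup>/\<^sup>2\<close> fixed points. Hence \<open>MS S N\<close> is, up to a bounded error, the sum of \<open>1 / n\<close> over the
  admissible \<open>n \<le> N\<close>.

  By a form of Rankin's trick this sum is asymptotic to the product of \<open>1 + 1 / p\<close> over \<open>p \<in> P\<close>, \<open>p \<le> N\<close>,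
  as long as the product varies slowly enough. A weak form of Mertens' theorem provides primes
  of sufficient density to choose \<open>P\<close> greedily such that the product follows
  \<open>k (ln (ln N))\<^sup>r\<close>.\<close>

section \<open>The ring \<open>RS S\<close> and its characters\<close>

text \<open>No primitive prime divisors of 2^n - 1 have to be exhibited: either all 2^n - 1 points
  survive, or so few that they stay summable after division by 2^n. Squarefree numbers over finitely
  many primes form a finite set, so the Euler product is a finite identity. The constant k demands a
  true asymptotic and not just an order of magnitude; hence the sum of ln (1 + 1/p) over the chosen
  primes up to N must follow ln k + r ln ln ln N with error o(1). The greedy choice achieves this if
  every interval (x, x^6] carries a fixed positive amount of the sum of 1/p over primes, because ln
  ln ln (x^6) - ln ln ln x tends to 0; elementary bounds on n! give such an amount. "Slowly enough"
  means that the product up to N^(1 / ln ln N) is asymptotic to the product up to N: ln ln drops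
  only by ln ln ln N between the two. As \<open>MS\<close> is defined by the entropy and the orbits
  themselves, the value ln 2 and the numbers of periodic points have to be derived from the
  definitions.\<close>

lemma padic_abs_le_1_iff:
  assumes "prime p"
  shows "padic_abs p r \<le> 1 \<longleftrightarrow> \<not> int p dvd snd (quotient_of r)"
proof (cases "r = 0")
  case False
  obtain a b where ab: "quotient_of r = (a, b)" by (cases "quotient_of r")
  have b: "b > 0" "coprime a b" using ab quotient_of_denom_pos quotient_of_coprime by auto
  have a: "a \<noteq> 0" using ab False quotient_of_div by fastforce
  have p: "prime (int p)" "real p > 1" using assms prime_gt_1_nat by auto
  have abs: "padic_abs p r = real p powi (int (multiplicity (int p) b) - int (multiplicity (int p) a))"
    using False ab by (simp add: padic_abs_def)
  show ?thesis
  proof (cases "int p dvd b")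
    case True
    then have "\<not> int p dvd a" using b p(1) by (meson coprime_common_divisor not_prime_unit)
    then have "multiplicity (int p) a = 0" by (rule not_dvd_imp_multiplicity_0)
    moreover have "multiplicity (int p) b > 0"
      using True b p by (simp add: prime_multiplicity_gt_zero_iff)
    ultimately have "padic_abs p r > 1" using p abs by simp
    then show ?thesis using True ab by simp
  next
    case not_dvd: False
    then have "padic_abs p r = inverse (real p ^ multiplicity (int p) a)"
      using abs by (simp add: not_dvd_imp_multiplicity_0 power_int_minus)
    moreover have "real p ^ multiplicity (int p) a \<ge> 1" using p by simp
    ultimately have "padic_abs p r \<le> 1" by (simp add: inverse_le_1_iff)
    then show ?thesis using not_dvd ab by simp
  qed
qed (use assms in \<open>auto simp: padic_abs_def\<close>)

definition smooth_over :: "nat set \<Rightarrow> nat \<Rightarrow> bool" where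
  "smooth_over S s \<longleftrightarrow> s > 0 \<and> prime_factors s \<subseteq> S"

lemma smooth_over_1 [simp]: "smooth_over S 1" "smooth_over S (Suc 0)"
  by (auto simp: smooth_over_def)

lemma smooth_over_mult: "smooth_over S s \<Longrightarrow> smooth_over S t \<Longrightarrow> smooth_over S (s * t)"
  by (auto simp: smooth_over_def prime_factors_product)

text \<open>\<open>RS S\<close> is the localisation of the integers at the \<open>S\<close>-smooth
  numbers. A denominator in lowest terms divides every other denominator, so it suffices to exhibit
  one smooth denominator.\<close>

lemma RS_iff: "r \<in> RS S \<longleftrightarrow> (\<exists>a s. smooth_over S s \<and> r = of_int a / of_nat s)"
proof
  assume r: "r \<in> RS S"
  obtain a b where ab: "quotient_of r = (a, b)" by (cases "quotient_of r")
  have b: "b > 0" using ab quotient_of_denom_pos by auto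
  have "smooth_over S (nat b)"
    unfolding smooth_over_def
  proof (intro conjI subsetI)
    fix p assume p: "p \<in> prime_factors (nat b)"
    then have pp: "prime p" "p dvd nat b" by auto
    then have "int p dvd b" using b by (metis int_dvd_int_iff int_nat_eq less_imp_le)
    then have "\<not> padic_abs p r \<le> 1" using padic_abs_le_1_iff[OF pp(1), of r] ab by simp
    then show "p \<in> S" using r pp by (auto simp: RS_def)
  qed (use b in simp)
  moreover have "r = of_int a / of_nat (nat b)" using quotient_of_div[OF ab] b by simp
  ultimately show "\<exists>a s. smooth_over S s \<and> r = of_int a / of_nat s" by blast
next
  assume "\<exists>a s. smooth_over S s \<and> r = of_int a / of_nat s"
  then obtain a s where s: "smooth_over S s" and r: "r = of_int a / of_nat s" by blast
  obtain a' b' where ab: "quotient_of r = (a', b')" by (cases "quotient_of r")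
  have b: "b' > 0" "coprime a' b'" using ab quotient_of_denom_pos quotient_of_coprime by auto
  have "of_int a / of_nat s = (of_int a' / of_int b' :: rat)" using quotient_of_div[OF ab] r by simp
  then have "of_int (a * b') = (of_int (a' * int s) :: rat)"
    using s b by (simp add: smooth_over_def field_simps)
  then have "a * b' = a' * int s" by linarith
  then have "b' dvd a' * int s" by (metis dvd_triv_right)
  then have bs: "b' dvd int s" using b by (simp add: coprime_commute coprime_dvd_mult_right_iff)
  show "r \<in> RS S"
    unfolding RS_def
  proof (intro CollectI allI impI)
    fix p assume p: "prime p \<and> p \<notin> S"
    have "\<not> int p dvd b'"
    proof
      assume "int p dvd b'"
      then have "p dvd s" using bs by (meson dvd_trans int_dvd_int_iff)
      then show False using p s by (auto simp: smooth_over_def in_prime_factors_iff)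
    qed
    then show "padic_abs p r \<le> 1" using p ab by (simp add: padic_abs_le_1_iff)
  qed
qed

lemma RS_of_int [simp, intro]: "of_int a \<in> RS S"
  unfolding RS_iff by (rule exI[of _ a], rule exI[of _ 1]) simp

lemma RS_of_nat [simp, intro]: "of_nat a \<in> RS S"
  using RS_of_int[of "int a"] by simp

lemma RS_0 [simp, intro]: "0 \<in> RS S" and RS_1 [simp, intro]: "1 \<in> RS S"
  using RS_of_int[of 0] RS_of_int[of 1] by simp_all

lemma RS_add [intro]: "x \<in> RS S \<Longrightarrow> y \<in> RS S \<Longrightarrow> x + y \<in> RS S"
  unfolding RS_iff
proof (elim exE conjE)
  fix a s b t assume *: "smooth_over S s" "x = of_int a / of_nat s" "smooth_over S t" "y = of_int b / of_nat t"
  then have "x + y = of_int (a * int t + b * int s) / of_nat (s * t)"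
    by (simp add: smooth_over_def field_simps)
  then show "\<exists>a s. smooth_over S s \<and> x + y = of_int a / of_nat s"
    using * smooth_over_mult by blast
qed

lemma RS_mult [intro]: "x \<in> RS S \<Longrightarrow> y \<in> RS S \<Longrightarrow> x * y \<in> RS S"
  unfolding RS_iff
proof (elim exE conjE)
  fix a s b t assume *: "smooth_over S s" "x = of_int a / of_nat s" "smooth_over S t" "y = of_int b / of_nat t"
  then have "x * y = of_int (a * b) / of_nat (s * t)" by simp
  then show "\<exists>a s. smooth_over S s \<and> x * y = of_int a / of_nat s"
    using * smooth_over_mult by blast
qed

lemma RS_inverse_smooth [intro]: "smooth_over S s \<Longrightarrow> 1 / of_nat s \<in> RS S"
  unfolding RS_iff by (rule exI[of _ 1], rule exI[of _ s]) simp

lemma RS_divide_smooth [intro]: "x \<in> RS S \<Longrightarrow> smooth_over S s \<Longrightarrow> x / of_nat s \<in> RS S"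
  using RS_mult[OF _ RS_inverse_smooth] by simp

lemma RS_power_2_mult [intro]: "x \<in> RS S \<Longrightarrow> 2 ^ n * x \<in> RS S"
  using RS_mult[OF RS_of_nat[of "2 ^ n"]] by simp

lemma RS_diff [intro]: "x \<in> RS S \<Longrightarrow> y \<in> RS S \<Longrightarrow> x - y \<in> RS S"
  using RS_add[OF _ RS_mult[OF RS_of_int[of "-1"]], of x S y] by simp

section \<open>Characters and the fixed points of the iterates of \<open>TS S\<close>\<close>

lemma topspace_dual_RS: "topspace (dual_RS S) = characters S"
  by (auto simp: dual_RS_def characters_def)

lemma
  assumes "f \<in> characters S"
  shows character_norm: "x \<in> RS S \<Longrightarrow> norm (f x) = 1"
    and character_add: "x \<in> RS S \<Longrightarrow> y \<in> RS S \<Longrightarrow> f (x + y) = f x * f y"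
    and character_extensional: "x \<notin> RS S \<Longrightarrow> f x = undefined"
    and character_nz: "x \<in> RS S \<Longrightarrow> f x \<noteq> 0"
  using assms by (auto simp: characters_def PiE_iff extensional_def)

lemma characterI:
  assumes "\<And>x. x \<in> RS S \<Longrightarrow> norm (f x) = 1" "\<And>x. x \<notin> RS S \<Longrightarrow> f x = undefined"
    "\<And>x y. x \<in> RS S \<Longrightarrow> y \<in> RS S \<Longrightarrow> f (x + y) = f x * f y"
  shows "f \<in> characters S"
  using assms by (auto simp: characters_def PiE_iff extensional_def)

lemma character_0: "f \<in> characters S \<Longrightarrow> f 0 = 1"
  using character_add[of f S 0 0] character_nz[of f S 0] by simp

lemma character_of_nat_mult:
  assumes "f \<in> characters S" "x \<in> RS S"
  shows "f (of_nat n * x) = f x ^ n"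
proof (induction n)
  case (Suc n)
  have "of_nat n * x \<in> RS S" using assms by blast
  then show ?case using assms character_add[OF assms(1) assms(2), of "of_nat n * x"] Suc
    by (simp add: algebra_simps)
qed (simp add: character_0[OF assms(1)])

lemma TS_characters:
  assumes "f \<in> characters S"
  shows "TS S f \<in> characters S"
proof (rule characterI)
  have two: "2 * x \<in> RS S" if "x \<in> RS S" for x using RS_power_2_mult[OF that, of 1] by simp
  show "norm (TS S f x) = 1" if "x \<in> RS S" for x
    using that two assms by (simp add: TS_def character_norm)
  show "TS S f (x + y) = TS S f x * TS S f y" if "x \<in> RS S" "y \<in> RS S" for x y
    using that two assms by (simp add: TS_def RS_add distrib_left character_add)
qed (simp add: TS_def)

lemma TS_funpow_characters: "f \<in> characters S \<Longrightarrow> (TS S ^^ n) f \<in> characters S"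
  by (induction n) (auto intro: TS_characters)

lemma TS_funpow:
  assumes "f \<in> characters S" "r \<in> RS S"
  shows "(TS S ^^ n) f r = f (2 ^ n * r)"
  using assms
proof (induction n arbitrary: r)
  case (Suc n)
  have "2 * r \<in> RS S" using RS_power_2_mult[OF Suc.prems(2), of 1] by simp
  then show ?case using Suc by (simp add: TS_def mult_ac)
qed simp

lemma character_eqI:
  assumes "f \<in> characters S" "g \<in> characters S" "\<And>x. x \<in> RS S \<Longrightarrow> f x = g x"
  shows "f = g"
proof
  fix x show "f x = g x"
    using assms character_extensional[OF assms(1)] character_extensional[OF assms(2)]
    by (cases "x \<in> RS S") auto
qed

text \<open>The n-th iterate sends f(r) to f(2^n r), and f(r) can be cancelled. So the fixed points
  form the annihilator of the subgroup (2^n - 1) \<open>RS S\<close>, which is the dual of the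
  quotient, and counting them means computing the order of that quotient.\<close>

lemma TS_funpow_fixed_iff:
  assumes "f \<in> characters S"
  shows "(TS S ^^ n) f = f \<longleftrightarrow> (\<forall>r\<in>RS S. f (of_nat (2 ^ n - 1) * r) = 1)"
proof -
  have "(TS S ^^ n) f = f \<longleftrightarrow> (\<forall>r\<in>RS S. (TS S ^^ n) f r = f r)"
    using character_eqI[OF TS_funpow_characters[OF assms] assms] by auto
  also have "\<dots> \<longleftrightarrow> (\<forall>r\<in>RS S. f (of_nat (2 ^ n - 1) * r) = 1)"
  proof (intro ball_cong refl)
    fix r assume r: "r \<in> RS S"
    have "(TS S ^^ n) f r = f (of_nat (2 ^ n - 1) * r + r)"
      using TS_funpow[OF assms r] by (simp add: of_nat_diff algebra_simps)
    also have "\<dots> = f (of_nat (2 ^ n - 1) * r) * f r"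
      by (rule character_add[OF assms]) (use r in blast)+
    finally show "(TS S ^^ n) f r = f r \<longleftrightarrow> f (of_nat (2 ^ n - 1) * r) = 1"
      using character_nz[OF assms r] by simp
  qed
  finally show ?thesis .
qed

text \<open>\<open>R\<^sub>S / m R\<^sub>S\<close> is cyclic of order \<open>m'\<close>, so that a character of it is determined by
  an \<open>m'\<close>-th root of unity.\<close>

lemma
  assumes m: "m = u * m'" "m' > 0" "smooth_over S u" "\<And>p. prime p \<Longrightarrow> p dvd m' \<Longrightarrow> p \<notin> S"
  defines "A \<equiv> {f \<in> characters S. \<forall>r\<in>RS S. f (of_nat m * r) = 1}"
  shows card_annihilator: "card A = m'" and finite_annihilator: "finite A"
proof -
  have u: "u > 0" using m by (simp add: smooth_over_def)
  have cop: "coprime (int m') (int s)" if "smooth_over S s" for s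
  proof -
    have "coprime m' s"
    proof (rule ccontr)
      assume "\<not> coprime m' s"
      then obtain p where "prime p" "p dvd m'" "p dvd s"
        by (metis coprime_iff_gcd_eq_1 gcd_nat.bounded_iff prime_factor_nat)
      then show False using that m(4) by (auto simp: smooth_over_def in_prime_factors_iff)
    qed
    then show ?thesis by simp
  qed
  \<comment> \<open>Every element is congruent to a natural number modulo m' \<open>RS S\<close>:
    its denominator is coprime to m', hence invertible modulo m'.\<close>
  have ex: "\<exists>c::nat. (r - of_nat c) / of_nat m' \<in> RS S" if rS: "r \<in> RS S" for r
  proof -
    obtain a s where s: "smooth_over S s" and r: "r = of_int a / of_nat s"
      using iffD1[OF RS_iff rS] by blast
    obtain x where "[int s * x = 1] (mod int m')"
      using cong_solve_coprime_int cop[OF s] by (metis coprime_commute)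
    then have "[a * (int s * x) = a * 1] (mod int m')" by (intro cong_mult cong_refl)
    define c where "c = nat ((a * x) mod int m')"
    have c: "int c = (a * x) mod int m'" using m(2) by (simp add: c_def)
    have "[int s * int c = int s * (a * x)] (mod int m')"
      unfolding c by (intro cong_mult cong_refl) simp
    also have "int s * (a * x) = a * (int s * x)" by simp
    also have "[\<dots> = a * 1] (mod int m')" by fact
    finally have "int m' dvd a - int s * int c"
      by (metis cong_iff_dvd_diff cong_sym mult.right_neutral)
    then obtain b where b: "a - int s * int c = int m' * b" by blast
    have "of_int (a - int s * int c) = (of_int (int m' * b) :: rat)" using b by simp
    then have "(r - of_nat c) / of_nat m' = of_int b / of_nat s"
      using s m(2) r by (simp add: smooth_over_def field_simps)
    then show ?thesis using s RS_iff by auto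
  qed
  define c :: "rat \<Rightarrow> nat" where "c r = (SOME c. (r - of_nat c) / of_nat m' \<in> RS S)" for r
  have c: "(r - of_nat (c r)) / of_nat m' \<in> RS S" if "r \<in> RS S" for r
    unfolding c_def using ex[OF that] by (rule someI_ex)
  \<comment> \<open>Conversely an integer in m' \<open>RS S\<close> is a multiple of m', so the
    residue \<open>c r\<close> found above is unique modulo m'.\<close>
  have dvd: "int m' dvd j" if jS: "of_int j / of_nat m' \<in> RS S" for j
  proof -
    obtain a s where s: "smooth_over S s" and r: "of_int j / of_nat m' = (of_int a / of_nat s :: rat)"
      using iffD1[OF RS_iff jS] by blast
    then have "of_int (j * int s) = (of_int (a * int m') :: rat)"
      using m(2) by (simp add: smooth_over_def field_simps)
    then have "j * int s = a * int m'" by linarith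
    then have "int m' dvd j * int s" by simp
    then show ?thesis using cop[OF s] by (simp add: coprime_dvd_mult_left_iff)
  qed
  have pow_cong: "z ^ i = z ^ j" if z: "z ^ m' = 1" and "int m' dvd int i - int j" for z :: complex and i j
  proof -
    have "[i = j] (mod m')" using that(2) by (simp add: cong_iff_dvd_diff flip: cong_int_iff)
    then have ij: "i mod m' = j mod m'" by (simp add: cong_def)
    have red: "z ^ k = z ^ (k mod m')" for k
    proof -
      have "z ^ k = z ^ (m' * (k div m') + k mod m')" by simp
      also have "\<dots> = z ^ (k mod m')" unfolding power_add power_mult z by simp
      finally show ?thesis .
    qed
    show ?thesis using red[of i] red[of j] ij by simp
  qed
  \<comment> \<open>The character with value \<open>z\<close> at 1. Its exponent depends on the
    arbitrary choice of \<open>c r\<close>, but only modulo m', which is invisible to an m'-th root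
    of unity.\<close>
  define ext where "ext z = (\<lambda>r\<in>RS S. z ^ c r)" for z :: complex
  \<comment> \<open>Since \<open>u\<close> is a unit of \<open>RS S\<close>, the ideals generated by
    \<open>m\<close> and by m' agree: m' equals \<open>m\<close> times 1/u.\<close>
  have one: "f 1 ^ m' = 1" if "f \<in> A" for f
  proof -
    have f: "f \<in> characters S" using that by (simp add: A_def)
    have "f 1 ^ m' = f (of_nat m' * 1)" by (rule character_of_nat_mult[OF f, symmetric]) simp
    also have "\<dots> = f (of_nat m * (1 / of_nat u))" using u by (simp add: m(1))
    also have "\<dots> = 1" using that RS_inverse_smooth[OF m(3)] unfolding A_def by blast
    finally show ?thesis .
  qed
  have val: "f r = f 1 ^ c r" if f: "f \<in> A" and r: "r \<in> RS S" for f r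
  proof -
    let ?\<rho> = "(r - of_nat (c r)) / of_nat m'"
    have \<rho>: "?\<rho> / of_nat u \<in> RS S" using c[OF r] m(3) by blast
    have fc: "f \<in> characters S" using f by (simp add: A_def)
    have "f r = f (of_nat (c r) * 1 + of_nat m * (?\<rho> / of_nat u))"
      using u m(2) by (simp add: m(1))
    also have "\<dots> = f (of_nat (c r) * 1) * f (of_nat m * (?\<rho> / of_nat u))"
      using RS_mult[OF RS_of_nat RS_1] RS_mult[OF RS_of_nat \<rho>] by (rule character_add[OF fc])
    also have "f (of_nat m * (?\<rho> / of_nat u)) = 1" using f \<rho> unfolding A_def by blast
    also have "f (of_nat (c r) * 1) = f 1 ^ c r" by (rule character_of_nat_mult[OF fc]) simp
    finally show ?thesis by simp
  qed
  have "bij_betw (\<lambda>f. f 1) A {z. z ^ m' = 1}"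
  proof (rule bij_betw_byWitness[where f' = ext])
    show "\<forall>f\<in>A. ext (f 1) = f"
    proof
      fix f assume f: "f \<in> A"
      then have fc: "f \<in> characters S" by (simp add: A_def)
      show "ext (f 1) = f"
      proof
        fix r
        show "ext (f 1) r = f r"
          using val[OF f, of r] character_extensional[OF fc, of r] by (cases "r \<in> RS S") (simp_all add: ext_def)
      qed
    qed
    show "\<forall>z\<in>{z. z ^ m' = 1}. ext z 1 = z"
    proof
      fix z :: complex assume z: "z \<in> {z. z ^ m' = 1}"
      have "int m' dvd 1 - int (c 1)" using c[of 1] by (intro dvd) simp
      then have "int m' dvd int (c 1) - int 1" by (simp add: dvd_diff_commute)
      then have "z ^ c 1 = z ^ 1" using z by (intro pow_cong) auto
      then show "ext z 1 = z" by (simp add: ext_def)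
    qed
    show "(\<lambda>f. f 1) ` A \<subseteq> {z. z ^ m' = 1}" using one by auto
    show "ext ` {z. z ^ m' = 1} \<subseteq> A"
    proof (intro image_subsetI)
      fix z :: complex assume "z \<in> {z. z ^ m' = 1}"
      then have z: "z ^ m' = 1" by simp
      have "norm z ^ m' = 1" using z by (metis norm_one norm_power)
      then have nz: "norm z = 1" using m(2) power_eq_imp_eq_base[of "norm z" m' 1] by simp
      have "ext z \<in> characters S"
      proof (rule characterI)
        show "norm (ext z x) = 1" if "x \<in> RS S" for x
          using that nz by (simp add: ext_def norm_power)
        fix x y assume xy: "x \<in> RS S" "y \<in> RS S"
        \<comment> \<open>The residues of x, y and x + y are compatible modulo m'
          \<open>RS S\<close>; \<open>dvd\<close> turns this into a congruence of exponents.\<close>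
        have "((x - of_nat (c x)) / of_nat m' + (y - of_nat (c y)) / of_nat m') 
           - ((x + y) - of_nat (c (x + y))) / of_nat m' \<in> RS S"
          using c xy by (intro RS_diff RS_add) auto
        also have "((x - of_nat (c x)) / of_nat m' + (y - of_nat (c y)) / of_nat m') 
           - ((x + y) - of_nat (c (x + y))) / of_nat m' 
           = of_int (int (c (x + y)) - int (c x + c y)) / of_nat m'"
          using m(2) by (simp add: field_simps)
        finally have "z ^ c (x + y) = z ^ (c x + c y)" by (intro pow_cong[OF z] dvd)
        then show "ext z (x + y) = ext z x * ext z y"
          using xy by (simp add: ext_def RS_add power_add)
      qed (simp add: ext_def)
      moreover have "ext z (of_nat m * r) = 1" if r: "r \<in> RS S" for r
      proof -
        have mr: "of_nat m * r \<in> RS S" using r by blast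
        have "of_nat u * r - (of_nat m * r - of_nat (c (of_nat m * r))) / of_nat m' \<in> RS S"
          using c[OF mr] r by blast
        also have "of_nat u * r - (of_nat m * r - of_nat (c (of_nat m * r))) / of_nat m'
            = of_int (int (c (of_nat m * r)) - int 0) / of_nat m'"
          using m(2) by (simp add: m(1) field_simps)
        finally have "z ^ c (of_nat m * r) = z ^ 0" by (intro pow_cong[OF z] dvd)
        then show ?thesis using mr by (simp add: ext_def)
      qed
      ultimately show "ext z \<in> A" by (simp add: A_def)
    qed
  qed
  then show "card A = m'" "finite A"
    using card_nth_roots[of 1 m'] finite_nth_roots[of m' 1] m(2)
    by (auto simp: bij_betw_same_card bij_betw_finite)
qed

section \<open>Topological entropy\<close>

text \<open>The restriction to \<open>RS S\<close> of a character of the real line.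
  \<open>TS S\<close> acts on this one-parameter group by doubling \<open>t\<close>; it supplies the
  separated points for the lower bound of the entropy and the centres of the covering sets for the
  upper bound.\<close>

definition angle_char :: "nat set \<Rightarrow> real \<Rightarrow> rat \<Rightarrow> complex" where
  "angle_char S t = (\<lambda>r\<in>RS S. cis (2 * pi * t * of_rat r))"

lemma angle_char_characters: "angle_char S t \<in> characters S"
  by (rule characterI) (auto simp: angle_char_def RS_add of_rat_add distrib_left cis_mult)

lemma continuous_map_dual_RS_eval:
  assumes "r \<in> RS S"
  shows "continuous_map (dual_RS S) euclidean (\<lambda>f. f r)"
  unfolding dual_RS_def
  by (rule continuous_map_from_subtopology, rule continuous_map_product_projection[OF assms])

lemma openin_dual_RS_eval:
  assumes "r \<in> RS S" "open U"
  shows "openin (dual_RS S) {f \<in> characters S. f r \<in> U}"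
  using openin_continuous_map_preimage[OF continuous_map_dual_RS_eval[OF assms(1)], of U] assms(2)
  by (simp add: topspace_dual_RS)

text \<open>The characters are cut out of a product of circles, compact by Tychonoff, by closed
  conditions, one for each pair of arguments.\<close>

lemma compact_space_dual_RS: "compact_space (dual_RS S)"
proof -
  let ?X = "product_topology (\<lambda>_. euclidean) (RS S) :: (rat \<Rightarrow> complex) topology"
  let ?K = "RS S \<rightarrow>\<^sub>E sphere 0 1 :: (rat \<Rightarrow> complex) set"
  define H where "H = (\<lambda>(x, y). {f \<in> topspace ?X. f (x + y) - f x * f y \<in> {0::complex}})"
  have cl: "closedin ?X (H z)" if zz: "z \<in> RS S \<times> RS S" for z
  proof -
    obtain x y where z: "z = (x, y)" "x \<in> RS S" "y \<in> RS S" using zz by blast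
    have lim: "((\<lambda>f. f r) \<longlongrightarrow> f0 r) (atin ?X f0)" if "r \<in> RS S" "f0 \<in> topspace ?X" for r f0
      using continuous_map_product_projection[OF that(1), of "\<lambda>_. euclidean :: complex topology"] that(2)
      unfolding continuous_map_atin by simp
    have "continuous_map ?X euclidean (\<lambda>f. f (x + y) - f x * f y)"
      unfolding continuous_map_atin limitin_canonical_iff
      using z by (intro ballI tendsto_intros lim RS_add)
    then show ?thesis unfolding H_def z prod.case by (rule closedin_continuous_map_preimage) simp
  qed
  have "compactin ?X (characters S)"
  proof (rule closed_compactin)
    show "compactin ?X ?K" by (simp add: compactin_PiE)
    show "characters S \<subseteq> ?K" by (auto simp: characters_def)
    have "characters S = ?K \<inter> (\<Inter>z\<in>RS S \<times> RS S. H z)"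
      by (auto simp: characters_def H_def)
    moreover have "closedin ?X (?K \<inter> (\<Inter>z\<in>RS S \<times> RS S. H z))"
    proof (rule closedin_Int)
      show "closedin ?X ?K" by (simp add: closedin_product_topology)
      show "closedin ?X (\<Inter>z\<in>RS S \<times> RS S. H z)" by (rule closedin_INT) (use cl RS_0 in auto)
    qed
    ultimately show "closedin ?X (characters S)" by simp
  qed
  then show ?thesis unfolding dual_RS_def by (rule compact_space_subtopology)
qed

section \<open>Lower bound for the entropy by separated points\<close>

lemma finite_iter_join:
  assumes "finite \<U>"
  shows "finite (iter_join X T \<U> n)"
proof -
  have "iter_join X T \<U> n \<subseteq> (\<lambda>u. {x \<in> topspace X. \<forall>i<n. (T ^^ i) x \<in> u i}) ` ({..<n} \<rightarrow>\<^sub>E \<U>)"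
  proof
    fix W assume "W \<in> iter_join X T \<U> n"
    then obtain u where u: "W = {x \<in> topspace X. \<forall>i<n. (T ^^ i) x \<in> u i}" "\<forall>i<n. u i \<in> \<U>"
      by (auto simp: iter_join_def)
    then show "W \<in> (\<lambda>u. {x \<in> topspace X. \<forall>i<n. (T ^^ i) x \<in> u i}) ` ({..<n} \<rightarrow>\<^sub>E \<U>)"
      by (intro image_eqI[of _ _ "restrict u {..<n}"]) auto
  qed
  moreover have "finite ({..<n} \<rightarrow>\<^sub>E \<U>)" using assms by (intro finite_PiE) auto
  ultimately show ?thesis by (blast intro: finite_subset)
qed

lemma Union_iter_join:
  assumes "\<Union>\<U> = topspace X" "\<And>x. x \<in> topspace X \<Longrightarrow> T x \<in> topspace X"
  shows "\<Union>(iter_join X T \<U> n) = topspace X"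
proof
  show "topspace X \<subseteq> \<Union>(iter_join X T \<U> n)"
  proof
    fix x assume x: "x \<in> topspace X"
    have "(T ^^ i) x \<in> topspace X" for i by (induction i) (use x assms(2) in auto)
    then have "\<forall>i. \<exists>U\<in>\<U>. (T ^^ i) x \<in> U" using assms(1) by blast
    then obtain u where "\<forall>i. u i \<in> \<U> \<and> (T ^^ i) x \<in> u i" by metis
    then show "x \<in> \<Union>(iter_join X T \<U> n)" using x unfolding iter_join_def by blast
  qed
qed (auto simp: iter_join_def)

text \<open>Pigeonhole: each member of the cover contains at most one point of \<open>A\<close>.
  Finiteness of the cover guarantees that the \<open>LEAST\<close> in \<open>cover_number\<close>
  ranges over a nonempty set and is attained.\<close>

lemma cover_number_ge:
  assumes "finite \<V>" "\<Union>\<V> = topspace X" "A \<subseteq> topspace X"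
    and "\<And>V x y. V \<in> \<V> \<Longrightarrow> x \<in> A \<Longrightarrow> y \<in> A \<Longrightarrow> x \<in> V \<Longrightarrow> y \<in> V \<Longrightarrow> x = y"
  shows "card A \<le> cover_number X \<V>"
proof -
  have "\<exists>m. \<exists>\<W>\<subseteq>\<V>. finite \<W> \<and> \<Union>\<W> = topspace X \<and> card \<W> = m" using assms by blast
  then have "\<exists>\<W>\<subseteq>\<V>. finite \<W> \<and> \<Union>\<W> = topspace X \<and> card \<W> = cover_number X \<V>"
    unfolding cover_number_def by (rule LeastI_ex)
  then obtain \<W> where W: "\<W> \<subseteq> \<V>" "finite \<W>" "\<Union>\<W> = topspace X" "card \<W> = cover_number X \<V>"
    by blast
  have "\<forall>x\<in>A. \<exists>V\<in>\<W>. x \<in> V" using W assms(3) by blast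
  then obtain V where V: "\<And>x. x \<in> A \<Longrightarrow> V x \<in> \<W>" "\<And>x. x \<in> A \<Longrightarrow> x \<in> V x" by metis
  have "inj_on V A"
  proof (rule inj_onI)
    fix x y assume xy: "x \<in> A" "y \<in> A" "V x = V y"
    have "V x \<in> \<V>" using V(1)[OF xy(1)] W(1) by blast
    then show "x = y" using V(2)[OF xy(1)] V(2)[OF xy(2)] xy assms(4) by metis
  qed
  then have "card A \<le> card \<W>" using V W by (intro card_inj_on_le[of V]) auto
  then show ?thesis using W by simp
qed

text \<open>Write k - j = 2^v e with e odd. After i = n - 1 - v doublings the angles differ by e pi,
  an odd multiple of pi.\<close>

lemma angle_char_antipodal:
  assumes "j < k" "k < 2 ^ n"
  shows "\<exists>i<n. (TS S ^^ i) (angle_char S (real k / 2 ^ n)) 1 = - (TS S ^^ i) (angle_char S (real j / 2 ^ n)) 1"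
proof -
  define d where "d = k - j"
  have d: "d > 0" "d < 2 ^ n" "k = j + d" using assms by (auto simp: d_def)
  obtain e where e: "d = 2 ^ multiplicity 2 d * e" "\<not> 2 dvd e"
    using multiplicity_decompose'[of d 2] d by auto
  define v where "v = multiplicity 2 d"
  have "2 ^ v \<le> d" using e d by (simp add: v_def dvd_imp_le multiplicity_dvd)
  then have "(2::nat) ^ v < 2 ^ n" using d by linarith
  then have v: "v < n" by simp
  define i where "i = n - 1 - v"
  have i: "i < n" "i + v + 1 = n" using v by (auto simp: i_def)
  have val: "(TS S ^^ i) (angle_char S t) 1 = cis (2 * pi * t * 2 ^ i)" for t
    using TS_funpow[OF angle_char_characters RS_1, of i S t] RS_power_2_mult[OF RS_1, of i S]
    by (simp add: angle_char_def of_rat_power)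
  have "2 * pi * (real d / 2 ^ n) * 2 ^ i = real e * pi"
  proof -
    have "real d = 2 ^ v * real e" using e(1) by (metis of_nat_mult of_nat_numeral of_nat_power v_def)
    moreover have "(2 :: real) ^ n = 2 * 2 ^ i * 2 ^ v" unfolding i(2)[symmetric] by (simp add: power_add)
    ultimately show ?thesis by simp
  qed
  then have "cis (2 * pi * (real d / 2 ^ n) * 2 ^ i) = cis pi ^ e" by (simp only: Complex.DeMoivre)
  also have "\<dots> = -1" using e(2) by simp
  finally have "cis (2 * pi * (real d / 2 ^ n) * 2 ^ i) = -1" .
  moreover have "2 * pi * (real k / 2 ^ n) * 2 ^ i = 2 * pi * (real j / 2 ^ n) * 2 ^ i + 2 * pi * (real d / 2 ^ n) * 2 ^ i"
    by (simp add: d(3) add_divide_distrib algebra_simps)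
  ultimately have "cis (2 * pi * (real k / 2 ^ n) * 2 ^ i) = - cis (2 * pi * (real j / 2 ^ n) * 2 ^ i)"
    by (simp flip: cis_mult)
  then show ?thesis using val i(1) by auto
qed

lemma topological_entropy_TS_ge: "topological_entropy (dual_RS S) (TS S) \<ge> ereal (ln 2)"
proof -
  \<comment> \<open>Open half-planes never contain two antipodal points, and these four cover the
    punctured plane. By \<open>angle_char_antipodal\<close> no member of the n-fold join contains
    two of the 2^n characters with angles j / 2^n.\<close>
  define HP :: "complex set set" where
    "HP = {{z. Re z > 0}, {z. Re z < 0}, {z. Im z > 0}, {z. Im z < 0}}"
  define \<U> where "\<U> = (\<lambda>H. {f \<in> characters S. f 1 \<in> H}) ` HP"
  have HP: "open H" "z \<in> H \<Longrightarrow> - z \<notin> H" if "H \<in> HP" for H z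
    using that by (auto simp: HP_def open_halfspace_Re_gt open_halfspace_Re_lt
        open_halfspace_Im_gt open_halfspace_Im_lt)
  have HP_cover: "\<exists>H\<in>HP. z \<in> H" if "z \<noteq> 0" for z
    using that by (auto simp: HP_def complex_eq_iff)
  have fin: "finite \<U>" by (simp add: \<U>_def HP_def)
  have un: "\<Union>\<U> = topspace (dual_RS S)"
    using HP_cover character_nz[of _ S 1] by (auto simp: \<U>_def topspace_dual_RS)
  have "\<U> \<in> open_covers (dual_RS S)"
    unfolding open_covers_def using un HP(1) openin_dual_RS_eval[OF RS_1] by (auto simp: \<U>_def)
  moreover have "cover_entropy (dual_RS S) (TS S) \<U> \<ge> ereal (ln 2)"
    unfolding cover_entropy_def
  proof (rule le_Limsup)
    have "2 ^ n \<le> cover_number (dual_RS S) (iter_join (dual_RS S) (TS S) \<U> n)" for n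
    proof -
      define g where "g j = angle_char S (real j / 2 ^ n)" for j :: nat
      have sep: False if h: "j < k" "k < 2 ^ n" "W \<in> iter_join (dual_RS S) (TS S) \<U> n" "g j \<in> W" "g k \<in> W" for j k W
      proof -
        obtain i where i: "i < n" "(TS S ^^ i) (g k) 1 = - (TS S ^^ i) (g j) 1"
          using angle_char_antipodal[OF h(1,2), of S] unfolding g_def by blast
        obtain U where "U \<in> \<U>" "(TS S ^^ i) (g k) \<in> U" "(TS S ^^ i) (g j) \<in> U"
          using h(3-5) i(1) unfolding iter_join_def by blast
        then obtain H where "H \<in> HP" "(TS S ^^ i) (g k) 1 \<in> H" "(TS S ^^ i) (g j) 1 \<in> H"
          by (auto simp: \<U>_def)
        then show False using HP(2) i(2) by metis
      qed
      have cov: "\<Union>(iter_join (dual_RS S) (TS S) \<U> n) = topspace (dual_RS S)"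
        using un TS_characters by (intro Union_iter_join) (auto simp: topspace_dual_RS)
      have gX: "g ` {..<2 ^ n} \<subseteq> topspace (dual_RS S)"
        by (auto simp: g_def topspace_dual_RS angle_char_characters)
      have "inj_on g {..<2 ^ n}"
      proof (rule linorder_inj_onI)
        fix j k :: nat assume jk: "j < k" "j \<in> {..<2 ^ n}" "k \<in> {..<2 ^ n}"
        show "g j \<noteq> g k"
        proof
          assume "g j = g k"
          moreover have "g k \<in> \<Union>(iter_join (dual_RS S) (TS S) \<U> n)" using cov gX jk by auto
          ultimately show False using sep[OF jk(1)] jk(3) by auto
        qed
      qed auto
      then have "card (g ` {..<2 ^ n}) = 2 ^ n" by (simp add: card_image)
      moreover have "card (g ` {..<2 ^ n}) \<le> cover_number (dual_RS S) (iter_join (dual_RS S) (TS S) \<U> n)"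
      proof (rule cover_number_ge[OF finite_iter_join[OF fin] cov gX])
        fix W x y assume *: "W \<in> iter_join (dual_RS S) (TS S) \<U> n" "x \<in> g ` {..<2 ^ n}" "y \<in> g ` {..<2 ^ n}"
          "x \<in> W" "y \<in> W"
        then obtain j k where jk: "x = g j" "y = g k" "j < 2 ^ n" "k < 2 ^ n" by auto
        then show "x = y" using * sep[of j k W] sep[of k j W] by (cases j k rule: linorder_cases) auto
      qed
      ultimately show ?thesis by simp
    qed
    then have ge: "real n * ln 2 \<le> ln (real (cover_number (dual_RS S) (iter_join (dual_RS S) (TS S) \<U> n)))" for n
    proof -
      let ?c = "cover_number (dual_RS S) (iter_join (dual_RS S) (TS S) \<U> n)"
      assume *: "\<And>n. 2 ^ n \<le> cover_number (dual_RS S) (iter_join (dual_RS S) (TS S) \<U> n)"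
      have "(2::real) ^ n \<le> real ?c" using *[of n] by (metis of_nat_le_iff of_nat_numeral of_nat_power)
      moreover have "(2::real) ^ n > 0" by simp
      ultimately have "ln (2 ^ n) \<le> ln (real ?c)" by (subst ln_le_cancel_iff) linarith+
      then show ?thesis by (simp add: ln_realpow)
    qed
    show "\<forall>\<^sub>F n in sequentially. ereal (ln 2) \<le> ereal (ln (real (cover_number (dual_RS S) (iter_join (dual_RS S) (TS S) \<U> n))) / real n)"
      using eventually_gt_at_top[of 0]
      by eventually_elim (use ge in \<open>simp add: pos_le_divide_eq mult.commute\<close>)
  qed simp
  ultimately show ?thesis unfolding topological_entropy_def by (rule SUP_upper2)
qed

section \<open>Upper bound for the entropy by nets on the circle\<close>

lemma character_of_int_mult_dist:
  assumes "f \<in> characters S" "g \<in> characters S" "x \<in> RS S"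
  shows "norm (f (of_int a * x) - g (of_int a * x)) \<le> real_of_int \<bar>a\<bar> * norm (f x - g x)"
proof -
  have n: "norm (f x) = 1" "norm (g x) = 1" using assms by (auto simp: character_norm)
  have nat: "norm (f (of_nat n * x) - g (of_nat n * x)) \<le> real n * norm (f x - g x)" for n
    using norm_power_diff[of "f x" "g x" n] n assms by (simp add: character_of_nat_mult)
  show ?thesis
  proof (cases "a \<ge> 0")
    case True
    then show ?thesis using nat[of "nat a"] by simp
  next
    case False
    define y where "y = of_nat (nat (- a)) * x"
    have y: "y \<in> RS S" unfolding y_def using RS_of_nat assms(3) by (rule RS_mult)
    have ay: "of_int a * x = - y" using False by (simp add: y_def)
    have my: "- y \<in> RS S" using RS_diff[OF RS_0 y] by simp
    \<comment> \<open>Inversion on the unit circle is complex conjugation, an isometry; this reduces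
      negative multiples to positive ones, where powers satisfy a Lipschitz bound.\<close>
    have inv: "h (- y) = cnj (h y)" if h: "h \<in> characters S" for h
    proof -
      have "h (- y) * h y = h (- y + y)" using h my y by (rule character_add[symmetric])
      also have "\<dots> = 1" using character_0[OF h] by simp
      finally have "h (- y) * h y * cnj (h y) = cnj (h y)" by simp
      moreover have "h y * cnj (h y) = 1"
        using character_norm[OF h y] by (simp add: complex_norm_square[symmetric])
      ultimately show ?thesis by (simp add: mult.assoc)
    qed
    have "norm (f (- y) - g (- y)) = norm (f y - g y)"
      using inv assms by (metis complex_cnj_diff complex_mod_cnj)
    then show ?thesis using nat[of "nat (- a)"] False unfolding ay by (simp add: y_def)
  qed
qed

text \<open>Finitely many values of a character are all integral powers of its value at a single
  1/s. This collapses a basic open set, which restricts finitely many coordinates, to a condition on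
  one circle.\<close>

lemma exists_common_denominator:
  assumes "finite E" "E \<subseteq> RS S"
  shows "\<exists>s. smooth_over S s \<and> (\<forall>r\<in>E. \<exists>a. r = of_int a / of_nat s)"
  using assms
proof (induction E rule: finite_induct)
  case empty
  then show ?case using smooth_over_1 by blast
next
  case (insert r E)
  then obtain s where s: "smooth_over S s" "\<forall>r\<in>E. \<exists>a. r = of_int a / of_nat s" by auto
  have "r \<in> RS S" using insert.prems by simp
  then obtain b t where t: "smooth_over S t" "r = of_int b / of_nat t" unfolding RS_iff by blast
  show ?case
  proof (intro exI[of _ "s * t"] conjI ballI)
    show "smooth_over S (s * t)" using s t smooth_over_mult by blast
    fix q assume "q \<in> insert r E"
    then consider "q = r" | "q \<in> E" by blast
    then show "\<exists>a. q = of_int a / of_nat (s * t)"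
    proof cases
      case 1
      then show ?thesis using s t by (intro exI[of _ "b * int s"]) (simp add: smooth_over_def)
    next
      case 2
      then obtain a where "q = of_int a / of_nat s" using s by blast
      then show ?thesis using s t by (intro exI[of _ "a * int t"]) (simp add: smooth_over_def)
    qed
  qed
qed

lemma openin_dual_RS_box:
  assumes "openin (dual_RS S) V" "x \<in> V"
  shows "\<exists>E \<epsilon>. finite E \<and> E \<subseteq> RS S \<and> \<epsilon> > 0 \<and> {g \<in> characters S. \<forall>r\<in>E. norm (g r - x r) < \<epsilon>} \<subseteq> V"
proof -
  obtain W where W: "openin (product_topology (\<lambda>_. euclidean) (RS S)) W" "V = W \<inter> characters S"
    using assms(1) unfolding dual_RS_def openin_subtopology by blast
  then obtain U where U: "finite {i \<in> RS S. U i \<noteq> UNIV}" "\<forall>i\<in>RS S. open (U i)"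
    "x \<in> Pi\<^sub>E (RS S) U" "Pi\<^sub>E (RS S) U \<subseteq> W"
    using assms(2) unfolding openin_product_topology_alt by fastforce
  define E where "E = {i \<in> RS S. U i \<noteq> UNIV}"
  have "\<forall>i\<in>E. \<exists>e>0. ball (x i) e \<subseteq> U i"
    using U(2,3) by (intro ballI open_contains_ball[THEN iffD1, rule_format]) (auto simp: E_def PiE_iff)
  then obtain e where e: "\<And>i. i \<in> E \<Longrightarrow> e i > 0" "\<And>i. i \<in> E \<Longrightarrow> ball (x i) (e i) \<subseteq> U i" by metis
  define \<epsilon> where "\<epsilon> = Min (insert 1 (e ` E))"
  have fin: "finite E" using U(1) by (simp add: E_def)
  have "\<epsilon> > 0" using fin e(1) by (auto simp: \<epsilon>_def)
  moreover have "{g \<in> characters S. \<forall>r\<in>E. norm (g r - x r) < \<epsilon>} \<subseteq> V"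
  proof
    fix g assume g: "g \<in> {g \<in> characters S. \<forall>r\<in>E. norm (g r - x r) < \<epsilon>}"
    have "g r \<in> U r" if r: "r \<in> RS S" for r
    proof (cases "r \<in> E")
      case True
      have "\<epsilon> \<le> e r" unfolding \<epsilon>_def using True fin by (intro Min_le) auto
      then have "g r \<in> ball (x r) (e r)" using g True by (auto simp: dist_norm norm_minus_commute)
      then show ?thesis using e(2)[OF True] by blast
    qed (use r in \<open>auto simp: E_def\<close>)
    then have "g \<in> Pi\<^sub>E (RS S) U" using g by (auto simp: characters_def PiE_iff)
    then show "g \<in> V" using U(4) W(2) g by blast
  qed
  ultimately show ?thesis using fin by (intro exI[of _ E] exI[of _ \<epsilon>]) (auto simp: E_def)
qed

text \<open>A Lebesgue number lemma: an open cover is refined by the pullback of balls of the circle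
  under \<open>f \<mapsto> f (1 / s)\<close>, which maps \<open>TS S\<close> to the squaring map.\<close>

lemma open_cover_Lebesgue:
  assumes "\<U> \<in> open_covers (dual_RS S)"
  shows "\<exists>s \<delta>. smooth_over S s \<and> \<delta> > 0 \<and> (\<forall>f\<in>characters S. \<exists>V\<in>\<U>. \<forall>g\<in>characters S.
    norm (f (1 / of_nat s) - g (1 / of_nat s)) < \<delta> \<longrightarrow> g \<in> V)"
proof -
  have U: "\<And>V. V \<in> \<U> \<Longrightarrow> openin (dual_RS S) V" "\<Union>\<U> = characters S"
    using assms by (auto simp: open_covers_def topspace_dual_RS)
  define good where "good x V E \<epsilon> \<longleftrightarrow> V \<in> \<U> \<and> finite E \<and> E \<subseteq> RS S \<and> \<epsilon> > 0 \<and>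
    {g \<in> characters S. \<forall>r\<in>E. norm (g r - x r) < \<epsilon>} \<subseteq> V" for x V E and \<epsilon> :: real
  have "\<exists>V E \<epsilon>. good x V E \<epsilon>" if x: "x \<in> characters S" for x
  proof -
    obtain V where "V \<in> \<U>" "x \<in> V" using U(2) x by blast
    then show ?thesis using openin_dual_RS_box[OF U(1), of V x] unfolding good_def by blast
  qed
  then obtain V E \<epsilon> where "\<And>x. x \<in> characters S \<Longrightarrow> good x (V x) (E x) (\<epsilon> x)" by metis
  then have VE: "\<And>x. x \<in> characters S \<Longrightarrow> V x \<in> \<U>" "\<And>x. x \<in> characters S \<Longrightarrow> finite (E x)"
    "\<And>x. x \<in> characters S \<Longrightarrow> E x \<subseteq> RS S" "\<And>x. x \<in> characters S \<Longrightarrow> \<epsilon> x > 0"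
    "\<And>x. x \<in> characters S \<Longrightarrow> {g \<in> characters S. \<forall>r\<in>E x. norm (g r - x r) < \<epsilon> x} \<subseteq> V x"
    unfolding good_def by blast+
  \<comment> \<open>Radii are halved so that a character close to some point of \<open>B x\<close>
    still lies in \<open>V x\<close>, by the triangle inequality.\<close>
  define B where "B x = {g \<in> characters S. \<forall>r\<in>E x. norm (g r - x r) < \<epsilon> x / 2}" for x
  have "openin (dual_RS S) (B x)" if x: "x \<in> characters S" for x
  proof -
    have "B x = characters S \<inter> (\<Inter>r\<in>E x. {g \<in> characters S. g r \<in> ball (x r) (\<epsilon> x / 2)})"
      by (auto simp: B_def dist_norm norm_minus_commute)
    also have "openin (dual_RS S) \<dots>"
    proof (cases "E x = {}")
      case True
      then show ?thesis using openin_topspace[of "dual_RS S"] by (simp add: topspace_dual_RS)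
    next
      case False
      then have "openin (dual_RS S) (\<Inter>r\<in>E x. {g \<in> characters S. g r \<in> ball (x r) (\<epsilon> x / 2)})"
        using VE(2,3)[OF x] by (intro openin_INT2 openin_dual_RS_eval) auto
      then show ?thesis using openin_Int[OF openin_topspace[of "dual_RS S"]] by (simp add: topspace_dual_RS)
    qed
    finally show ?thesis .
  qed
  then have "\<forall>U\<in>B ` characters S. openin (dual_RS S) U" by blast
  moreover have "characters S \<subseteq> \<Union>(B ` characters S)"
    using VE(4) by (auto simp: B_def)
  ultimately obtain \<F> where "finite \<F>" "\<F> \<subseteq> B ` characters S" "characters S \<subseteq> \<Union>\<F>"
    using compact_space_dual_RS[of S, unfolded compact_space_alt topspace_dual_RS,
        THEN spec, of "B ` characters S"] by auto
  then obtain F where F: "finite F" "F \<subseteq> characters S" "characters S \<subseteq> \<Union>(B ` F)"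
    by (metis finite_subset_image)
  have Fne: "F \<noteq> {}" using F(3) angle_char_characters by auto
  define E' where "E' = (\<Union>x\<in>F. E x)"
  define e where "e = Min ((\<lambda>x. \<epsilon> x / 2) ` F)"
  have "finite E'" using F(1,2) VE(2) unfolding E'_def by blast
  moreover have "E' \<subseteq> RS S" using F(2) VE(3) unfolding E'_def by blast
  ultimately have E': "finite E'" "E' \<subseteq> RS S" by auto
  have "\<forall>x\<in>F. \<epsilon> x / 2 > 0" using F(2) VE(4) by auto
  then have "e > 0" using F(1) Fne by (simp add: e_def)
  moreover have "e \<le> \<epsilon> x / 2" if "x \<in> F" for x
    unfolding e_def using F(1) that by (intro Min_le) auto
  ultimately have e: "e > 0" "\<And>x. x \<in> F \<Longrightarrow> e \<le> \<epsilon> x / 2" by blast+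
  obtain s where s: "smooth_over S s" "\<forall>r\<in>E'. \<exists>a. r = of_int a / of_nat s"
    using exists_common_denominator[OF E'] by blast
  then obtain a where a: "\<And>r. r \<in> E' \<Longrightarrow> r = of_int (a r) / of_nat s" by metis
  \<comment> \<open>A Lipschitz constant for passing from the value at 1/s to the values at all of
    the finitely many relevant arguments; inserting 1 keeps it positive when there are none.\<close>
  define K where "K = Max (insert 1 ((\<lambda>r. real_of_int \<bar>a r\<bar>) ` E'))"
  have K: "K \<ge> 1" "\<And>r. r \<in> E' \<Longrightarrow> real_of_int \<bar>a r\<bar> \<le> K"
    using E' by (auto simp: K_def)
  show ?thesis
  proof (intro exI[of _ s] exI[of _ "e / K"] conjI ballI s(1))
    show "e / K > 0" using e K by simp
    fix f assume f: "f \<in> characters S"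
    then obtain x where x: "x \<in> F" "f \<in> B x" using F(3) by blast
    have xc: "x \<in> characters S" using x F by blast
    show "\<exists>V\<in>\<U>. \<forall>g\<in>characters S. norm (f (1 / of_nat s) - g (1 / of_nat s)) < e / K \<longrightarrow> g \<in> V"
    proof (intro bexI[of _ "V x"] ballI impI)
      show "V x \<in> \<U>" using VE(1)[OF xc] .
      fix g assume g: "g \<in> characters S" and lt: "norm (f (1 / of_nat s) - g (1 / of_nat s)) < e / K"
      have "norm (g r - x r) < \<epsilon> x" if r: "r \<in> E x" for r
      proof -
        have rE: "r \<in> E'" using r x by (auto simp: E'_def)
        have "norm (f r - g r) \<le> real_of_int \<bar>a r\<bar> * norm (f (1 / of_nat s) - g (1 / of_nat s))"
          using character_of_int_mult_dist[OF f g RS_inverse_smooth[OF s(1)], of "a r"] a[OF rE] by simp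
        also have "\<dots> \<le> K * norm (f (1 / of_nat s) - g (1 / of_nat s))"
          using K(2)[OF rE] by (rule mult_right_mono) simp
        also have "\<dots> < e" using lt K(1) by (simp add: field_simps)
        also have "\<dots> \<le> \<epsilon> x / 2" using e(2)[OF x(1)] .
        finally have "norm (f r - g r) < \<epsilon> x / 2" .
        moreover have "norm (f r - x r) < \<epsilon> x / 2" using x(2) r by (simp add: B_def)
        moreover have "norm (g r - x r) \<le> norm (f r - x r) + norm (f r - g r)"
          using norm_triangle_ineq4[of "f r - x r" "f r - g r"] by simp
        ultimately show ?thesis by linarith
      qed
      then show "g \<in> V x" using VE(5)[OF xc] g by blast
    qed
  qed
qed

lemma norm_cis_diff_le: "norm (cis a - cis b) \<le> \<bar>a - b\<bar>"
proof -
  have "cis a - cis b = cis b * (cis (a - b) - 1)" by (simp add: algebra_simps cis_mult)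
  then have "norm (cis a - cis b) = norm (exp (\<i> * of_real (a - b)) - 1)"
    by (simp add: norm_mult cis_conv_exp)
  also have "\<dots> = 2 * \<bar>sin ((a - b) / 2)\<bar>" by (rule dist_exp_i_1)
  also have "\<dots> \<le> 2 * \<bar>(a - b) / 2\<bar>" using abs_sin_x_le_abs_x[of "(a - b) / 2"] by simp
  finally show ?thesis by simp
qed

lemma unit_circle_net:
  assumes "norm z = 1" "M > 0"
  shows "\<exists>j<M. norm (z - cis (2 * pi * real j / real M)) \<le> 2 * pi / real M"
proof -
  define \<theta> where "\<theta> = Arg2pi z"
  have \<theta>: "0 \<le> \<theta>" "\<theta> < 2 * pi" "z = cis \<theta>"
    using Arg2pi[of z] assms(1) by (auto simp: \<theta>_def is_Arg_def cis_conv_exp)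
  define x where "x = \<theta> * real M / (2 * pi)"
  have x: "0 \<le> x" "x < real M" using \<theta> assms(2) by (auto simp: x_def field_simps)
  define j where "j = nat \<lfloor>x\<rfloor>"
  have j: "real j \<le> x" "x < real j + 1" using x by (auto simp: j_def)
  have "norm (z - cis (2 * pi * real j / real M)) \<le> \<bar>\<theta> - 2 * pi * real j / real M\<bar>"
    unfolding \<theta>(3) by (rule norm_cis_diff_le)
  also have "\<theta> - 2 * pi * real j / real M = (x - real j) * (2 * pi / real M)"
    using assms(2) by (simp add: x_def field_simps)
  also have "\<bar>(x - real j) * (2 * pi / real M)\<bar> \<le> 1 * (2 * pi / real M)"
    unfolding abs_mult using j assms(2) by (intro mult_mono) auto
  finally show ?thesis using j x by (intro exI[of _ j]) auto
qed

lemma cover_number_le: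
  assumes "\<And>x. x \<in> topspace X \<Longrightarrow> \<exists>j<M. x \<in> W j" "\<And>j. j < M \<Longrightarrow> W j \<in> \<V>"
    "\<And>j. j < M \<Longrightarrow> W j \<subseteq> topspace X"
  shows "cover_number X \<V> \<le> M"
proof -
  have "cover_number X \<V> \<le> card (W ` {..<M})"
    unfolding cover_number_def using assms
    by (intro Least_le exI[of _ "W ` {..<M}"]) (fastforce simp: lessThan_iff)
  also have "\<dots> \<le> M" using card_image_le[of "{..<M}" W] by simp
  finally show ?thesis .
qed

text \<open>Take K 2^n equally spaced centres on the circle of values at 1/s. Fewer than n squarings
  expand distances by at most 2^n, so a point within 2 pi / (K 2^n) of a centre shadows it within 2
  pi / K, which is below the Lebesgue number. The join thus has a subcover of size K 2^n, whose
  exponential growth rate is ln 2.\<close>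

lemma cover_entropy_TS_le:
  assumes "\<U> \<in> open_covers (dual_RS S)"
  shows "cover_entropy (dual_RS S) (TS S) \<U> \<le> ereal (ln 2)"
proof -
  obtain s \<delta> where s: "smooth_over S s" and \<delta>: "\<delta> > 0" and
    "\<forall>f\<in>characters S. \<exists>V\<in>\<U>. \<forall>g\<in>characters S. norm (f (1 / of_nat s) - g (1 / of_nat s)) < \<delta> \<longrightarrow> g \<in> V"
    using open_cover_Lebesgue[OF assms] by blast
  then obtain V where V: "\<And>f. f \<in> characters S \<Longrightarrow> V f \<in> \<U>"
    "\<And>f g. f \<in> characters S \<Longrightarrow> g \<in> characters S \<Longrightarrow> norm (f (1 / of_nat s) - g (1 / of_nat s)) < \<delta> \<Longrightarrow> g \<in> V f"
    by metis
  have sRS: "1 / of_nat s \<in> RS S" using s by (rule RS_inverse_smooth)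
  obtain K where K: "2 * pi / \<delta> < real K" using reals_Archimedean2 by blast
  have "2 * pi / \<delta> > 0" using \<delta> by simp
  then have K0: "K > 0" using K by (cases K) auto
  have bound: "cover_number (dual_RS S) (iter_join (dual_RS S) (TS S) \<U> n) \<le> K * 2 ^ n" for n
  proof -
    define M where "M = K * 2 ^ n"
    have M: "M > 0" using K0 by (simp add: M_def)
    \<comment> \<open>The factor \<open>s\<close> compensates the evaluation at 1/s, so that the
      values there are the M-th roots of unity.\<close>
    define g where "g j = angle_char S (real s * real j / real M)" for j
    have gc: "g j \<in> characters S" for j by (simp add: g_def angle_char_characters)
    have gs: "g j (1 / of_nat s) = cis (2 * pi * real j / real M)" for j
      using sRS s by (simp add: g_def angle_char_def of_rat_divide smooth_over_def field_simps)
    define W where "W j = {x \<in> topspace (dual_RS S). \<forall>i<n. (TS S ^^ i) x \<in> V ((TS S ^^ i) (g j))}" for j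
    have "cover_number (dual_RS S) (iter_join (dual_RS S) (TS S) \<U> n) \<le> M"
    proof (rule cover_number_le)
      show "W j \<in> iter_join (dual_RS S) (TS S) \<U> n" for j
        unfolding iter_join_def W_def using V(1)[OF TS_funpow_characters[OF gc]]
        by (intro CollectI exI[of _ "\<lambda>i. V ((TS S ^^ i) (g j))"]) simp
      show "W j \<subseteq> topspace (dual_RS S)" for j by (auto simp: W_def)
      fix x assume "x \<in> topspace (dual_RS S)"
      then have x: "x \<in> characters S" by (simp add: topspace_dual_RS)
      obtain j where j: "j < M" "norm (x (1 / of_nat s) - cis (2 * pi * real j / real M)) \<le> 2 * pi / real M"
        using unit_circle_net[OF character_norm[OF x sRS] M] by blast
      have "(TS S ^^ i) x \<in> V ((TS S ^^ i) (g j))" if i: "i < n" for i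
      proof (rule V(2)[OF TS_funpow_characters[OF gc] TS_funpow_characters[OF x]])
        have pw: "(TS S ^^ i) f (1 / of_nat s) = f (1 / of_nat s) ^ (2 ^ i)" if f: "f \<in> characters S" for f
          using TS_funpow[OF f sRS, of i] character_of_nat_mult[OF f sRS, of "2 ^ i"] by simp
        have "norm ((TS S ^^ i) (g j) (1 / of_nat s) - (TS S ^^ i) x (1 / of_nat s))
            = norm (g j (1 / of_nat s) ^ (2 ^ i) - x (1 / of_nat s) ^ (2 ^ i))"
          by (simp add: pw gc x)
        also have "\<dots> \<le> real (2 ^ i) * norm (g j (1 / of_nat s) - x (1 / of_nat s))"
          using character_norm[OF gc sRS] character_norm[OF x sRS] by (intro norm_power_diff) auto
        also have "norm (g j (1 / of_nat s) - x (1 / of_nat s)) \<le> 2 * pi / real M"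
          using j(2) unfolding gs by (simp add: norm_minus_commute)
        also have "real (2 ^ i) * (2 * pi / real M) \<le> 2 ^ n * (2 * pi / real M)"
          using i by (intro mult_right_mono) (auto intro: power_increasing)
        also have "\<dots> = 2 * pi / real K" by (simp add: M_def)
        also have "\<dots> < \<delta>" using K \<delta> K0 by (simp add: field_simps)
        finally show "norm ((TS S ^^ i) (g j) (1 / of_nat s) - (TS S ^^ i) x (1 / of_nat s)) < \<delta>" 
          by simp
      qed
      then show "\<exists>j<M. x \<in> W j" using j(1) x by (auto simp: W_def topspace_dual_RS)
    qed
    then show ?thesis by (simp add: M_def)
  qed
  have "ln (real (cover_number (dual_RS S) (iter_join (dual_RS S) (TS S) \<U> n))) / real n \<le> ln (real K) / real n + ln 2"
    if "n > 0" for n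
  proof -
    let ?c = "cover_number (dual_RS S) (iter_join (dual_RS S) (TS S) \<U> n)"
    have "ln (real ?c) \<le> ln (real K) + real n * ln 2"
    \<comment> \<open>In the zero case \<open>ln 0 = 0\<close> and the right-hand side is
      nonnegative because \<open>K\<close> is at least 1.\<close>
    proof (cases "?c = 0")
      case False
      have "real ?c \<le> real K * 2 ^ n" using bound[of n] by (metis of_nat_le_iff of_nat_mult of_nat_numeral of_nat_power)
      then have "ln (real ?c) \<le> ln (real K * 2 ^ n)" using False K0 by (subst ln_le_cancel_iff) auto
      then show ?thesis using K0 by (simp add: ln_mult ln_realpow)
    qed (use K0 in simp)
    then show ?thesis using that by (simp add: field_simps)
  qed
  then have "cover_entropy (dual_RS S) (TS S) \<U> \<le> limsup (\<lambda>n. ereal (ln (real K) / real n + ln 2))"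
    unfolding cover_entropy_def
    by (intro Limsup_mono) (auto intro!: eventually_sequentiallyI[of 1])
  also have "(\<lambda>n. ereal (ln (real K) / real n + ln 2)) \<longlonglongrightarrow> ereal (0 + ln 2)"
    by (intro tendsto_intros lim_const_over_n)
  then have "limsup (\<lambda>n. ereal (ln (real K) / real n + ln 2)) = ereal (0 + ln 2)"
    by (intro lim_imp_Limsup) auto
  finally show ?thesis by simp
qed

lemma topological_entropy_TS: "topological_entropy (dual_RS S) (TS S) = ereal (ln 2)"
  using topological_entropy_TS_ge[of S] cover_entropy_TS_le[of _ S]
  by (intro antisym) (auto simp: topological_entropy_def intro: SUP_least)

section \<open>Closed orbits and periodic points\<close>

definition fixed_points :: "'a topology \<Rightarrow> ('a \<Rightarrow> 'a) \<Rightarrow> nat \<Rightarrow> 'a set" where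
  "fixed_points X T n = {x \<in> topspace X. (T ^^ n) x = x}"

text \<open>For length 0 the candidate set is a singleton and fails the cardinality
  condition.\<close>

lemma closed_orbits_0: "closed_orbits X T 0 = {}"
  by (auto simp: closed_orbits_def)

lemma closed_orbits_card: "\<tau> \<in> closed_orbits X T n \<Longrightarrow> card \<tau> = n"
  by (auto simp: closed_orbits_def)

text \<open>A closed orbit is generated by any of its points, since x is recovered from T^i x by n -
  i further steps. This makes distinct closed orbits disjoint.\<close>

lemma orbit_upto_eq:
  assumes "(T ^^ n) x = x" "n > 0" "y \<in> (\<lambda>i. (T ^^ i) x) ` {0..n}"
  shows "(T ^^ n) y = y" "(\<lambda>i. (T ^^ i) y) ` {0..n} = (\<lambda>i. (T ^^ i) x) ` {0..n}"
proof -
  obtain i where i: "i \<le> n" "y = (T ^^ i) x" using assms(3) by auto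
  have comm: "(T ^^ a) ((T ^^ b) z) = (T ^^ (a + b)) z" for a b z by (simp add: funpow_add)
  show Ty: "(T ^^ n) y = y"
    unfolding i(2) comm using assms(1) comm[of i n x] by (simp add: add.commute)
  have sub: "(\<lambda>i. (T ^^ i) b) ` {0..n} \<subseteq> (\<lambda>i. (T ^^ i) a) ` {0..n}"
    if "(T ^^ n) a = a" "b = (T ^^ k) a" for a b k
  proof (intro image_subsetI)
    fix j
    have "(T ^^ j) b = (T ^^ ((j + k) mod n)) a"
      unfolding that(2) comm using funpow_mod_eq[OF that(1)] by simp
    then show "(T ^^ j) b \<in> (\<lambda>i. (T ^^ i) a) ` {0..n}"
      using assms(2) by (intro image_eqI[of _ _ "(j + k) mod n"]) (auto simp: less_imp_le)
  qed
  have "x = (T ^^ (n - i)) y" unfolding i(2) comm using i(1) assms(1) by simp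
  then show "(\<lambda>i. (T ^^ i) y) ` {0..n} = (\<lambda>i. (T ^^ i) x) ` {0..n}"
    using sub[OF assms(1) i(2)] sub[OF Ty] by blast
qed

text \<open>The minimal period divides \<open>n\<close>, and is smaller than \<open>n\<close> when
  the orbit has a repetition; a proper divisor is at most n/2.\<close>

lemma exists_proper_period:
  assumes "(T ^^ n) x = x" "n > 0" "card ((\<lambda>i. (T ^^ i) x) ` {0..n}) \<noteq> n"
  shows "\<exists>d\<in>{1..n div 2}. (T ^^ d) x = x"
proof -
  let ?O = "(\<lambda>i. (T ^^ i) x)"
  have "?O ` {0..n} = ?O ` {..<n}"
  proof
    show "?O ` {0..n} \<subseteq> ?O ` {..<n}"
    proof (intro image_subsetI)
      fix i assume "i \<in> {0..n}"
      show "(T ^^ i) x \<in> ?O ` {..<n}"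
        using funpow_mod_eq[OF assms(1), of i] assms(2) by (intro image_eqI[of _ _ "i mod n"]) auto
    qed
  qed auto
  then have "\<not> inj_on ?O {..<n}" using assms(3) card_image[of ?O "{..<n}"] by auto
  then obtain i j where ij: "i < j" "j < n" "(T ^^ i) x = (T ^^ j) x"
    unfolding inj_on_def by (metis lessThan_iff nat_neq_iff)
  have comm: "(T ^^ a) ((T ^^ b) z) = (T ^^ (a + b)) z" for a b z by (simp add: funpow_add)
  \<comment> \<open>Applying n - j further steps to the repetition T^i x = T^j x returns to x after
    fewer than n steps.\<close>
  have "(T ^^ (n - j + i)) x = (T ^^ (n - j + j)) x" using ij(3) by (simp flip: comm)
  then have "\<exists>d>0. (T ^^ d) x = x" using ij assms(1) by (intro exI[of _ "n - j + i"]) auto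
  define d where "d = (LEAST d. d > 0 \<and> (T ^^ d) x = x)"
  have d: "d > 0" "(T ^^ d) x = x"
    using LeastI_ex[OF \<open>\<exists>d>0. (T ^^ d) x = x\<close>] by (auto simp: d_def)
  have least: "d \<le> e" if "e > 0" "(T ^^ e) x = x" for e
    unfolding d_def using that by (intro Least_le) simp
  have "d \<le> n - j + i"
    using least[of "n - j + i"] ij assms(1) \<open>(T ^^ (n - j + i)) x = (T ^^ (n - j + j)) x\<close> by auto
  then have "d < n" using ij by simp
  have "(T ^^ (n mod d)) x = x" using funpow_mod_eq[OF d(2), of n] assms(1) by simp
  then have "n mod d = 0" using least[of "n mod d"] d(1) by (metis leD mod_less_divisor neq0_conv)
  then obtain k where k: "n = d * k" by auto
  have "k \<noteq> 0" "k \<noteq> 1" using k \<open>d < n\<close> assms(2) by auto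
  then have "d * 2 \<le> d * k" by (intro mult_le_mono2) simp
  then have "d * 2 \<le> n" using k by simp
  then show ?thesis using d by (intro bexI[of _ d]) auto
qed

text \<open>Closed orbits of length n partition the points of exact period n, and every other fixed
  point of T^n already has a period at most n/2. This two-sided estimate takes the place of Moebius
  inversion.\<close>

lemma
  assumes "n > 0" "\<And>d. d > 0 \<Longrightarrow> finite (fixed_points X T d)"
    and "\<And>x. x \<in> topspace X \<Longrightarrow> T x \<in> topspace X"
  shows finite_closed_orbits: "finite (closed_orbits X T n)"
    and card_closed_orbits_le: "n * card (closed_orbits X T n) \<le> card (fixed_points X T n)"
    and card_closed_orbits_ge: "card (fixed_points X T n) \<le>
      n * card (closed_orbits X T n) + (\<Sum>d\<in>{1..n div 2}. card (fixed_points X T d))"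
proof -
  define L where "L = \<Union>(closed_orbits X T n)"
  have fn: "finite (fixed_points X T n)" using assms by simp
  have inv: "(T ^^ i) x \<in> topspace X" if "x \<in> topspace X" for i x
    by (induction i) (use that assms(3) in auto)
  have mem: "y \<in> fixed_points X T n" "\<tau> = (\<lambda>i. (T ^^ i) y) ` {0..n}"
    if \<tau>: "\<tau> \<in> closed_orbits X T n" "y \<in> \<tau>" for y \<tau>
  proof -
    obtain x where x: "x \<in> topspace X" "\<tau> = (\<lambda>i. (T ^^ i) x) ` {0..n}" "(T ^^ n) x = x"
      using \<tau>(1) unfolding closed_orbits_def by blast
    have y: "y \<in> (\<lambda>i. (T ^^ i) x) ` {0..n}" using \<tau>(2) x(2) by simp
    then have "y \<in> topspace X" using inv[OF x(1)] by blast
    then show "y \<in> fixed_points X T n" "\<tau> = (\<lambda>i. (T ^^ i) y) ` {0..n}"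
      using orbit_upto_eq[OF x(3) assms(1) y] x(2) by (simp_all add: fixed_points_def)
  qed
  have LF: "L \<subseteq> fixed_points X T n" using mem(1) by (auto simp: L_def)
  then have fL: "finite L" using fn by (rule finite_subset)
  then show fin: "finite (closed_orbits X T n)" unfolding L_def by (rule finite_UnionD)
  have card_L: "n * card (closed_orbits X T n) = card L"
    unfolding L_def
  proof (rule card_partition[OF fin])
    show "finite (\<Union>(closed_orbits X T n))" using fL by (simp add: L_def)
    show "card \<tau> = n" if "\<tau> \<in> closed_orbits X T n" for \<tau> using that by (rule closed_orbits_card)
    show "\<tau> \<inter> \<sigma> = {}" if "\<tau> \<in> closed_orbits X T n" "\<sigma> \<in> closed_orbits X T n" "\<tau> \<noteq> \<sigma>" for \<tau> \<sigma>
      using that mem(2) by (metis disjoint_iff)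
  qed
  show "n * card (closed_orbits X T n) \<le> card (fixed_points X T n)"
    unfolding card_L using fn LF by (rule card_mono)
  have "fixed_points X T n \<subseteq> L \<union> (\<Union>d\<in>{1..n div 2}. fixed_points X T d)"
  proof
    fix x assume x: "x \<in> fixed_points X T n"
    then have Tx: "(T ^^ n) x = x" "x \<in> topspace X" by (auto simp: fixed_points_def)
    show "x \<in> L \<union> (\<Union>d\<in>{1..n div 2}. fixed_points X T d)"
    proof (cases "card ((\<lambda>i. (T ^^ i) x) ` {0..n}) = n")
      case True
      then have "(\<lambda>i. (T ^^ i) x) ` {0..n} \<in> closed_orbits X T n"
        unfolding closed_orbits_def using Tx by blast
      moreover have "x \<in> (\<lambda>i. (T ^^ i) x) ` {0..n}" by (rule image_eqI[of _ _ 0]) auto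
      ultimately show ?thesis unfolding L_def by blast
    next
      case False
      then show ?thesis using exists_proper_period[OF Tx(1) assms(1)] Tx by (auto simp: fixed_points_def)
    qed
  qed
  then have "card (fixed_points X T n) \<le> card (L \<union> (\<Union>d\<in>{1..n div 2}. fixed_points X T d))"
    using fL assms(2) by (intro card_mono) auto
  also have "\<dots> \<le> card L + card (\<Union>d\<in>{1..n div 2}. fixed_points X T d)" by (rule card_Un_le)
  also have "card (\<Union>d\<in>{1..n div 2}. fixed_points X T d) \<le> (\<Sum>d\<in>{1..n div 2}. card (fixed_points X T d))"
    by (rule card_UN_le) simp
  finally show "card (fixed_points X T n) \<le>
      n * card (closed_orbits X T n) + (\<Sum>d\<in>{1..n div 2}. card (fixed_points X T d))"
    unfolding card_L by simp
qed

section \<open>A lower bound for sums over primes\<close>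

lemma card_multiples_atMost:
  fixes d n :: nat
  assumes "d > 0"
  shows "card {m\<in>{1..n}. d dvd m} = n div d"
proof -
  have "{m\<in>{1..n}. d dvd m} = (\<lambda>i. d * i) ` {1..n div d}"
  proof (intro Set.set_eqI iffI)
    fix m assume m: "m \<in> {m\<in>{1..n}. d dvd m}"
    then obtain i where i: "m = d * i" by blast
    have "1 \<le> m" "m \<le> n" using m by auto
    then have "i \<le> n div d" "1 \<le> i"
      using i assms div_le_mono[of m n d] by (simp, cases i) auto
    then show "m \<in> (\<lambda>i. d * i) ` {1..n div d}" using i by auto
  next
    fix m assume "m \<in> (\<lambda>i. d * i) ` {1..n div d}"
    then obtain i where "m = d * i" "i \<in> {1..n div d}" by blast
    then have i: "m = d * i" "1 \<le> i" "i \<le> n div d" by auto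
    have "d * i \<le> n" using i(3) assms
      by (metis div_times_less_eq_dividend dual_order.trans mult.commute mult_le_mono2)
    then show "m \<in> {m\<in>{1..n}. d dvd m}" using i assms by auto
  qed
  moreover have "inj_on (\<lambda>i. d * i) {1..n div d}" using assms by (auto simp: inj_on_def)
  ultimately show ?thesis by (simp add: card_image)
qed

lemma multiplicity_eq_card:
  fixes p m n :: nat
  assumes "prime p" "m > 0" "m \<le> n"
  shows "multiplicity p m = card {j\<in>{1..n}. p ^ j dvd m}"
proof -
  have nu: "\<not> is_unit p" using assms(1) by auto
  have *: "p ^ j dvd m \<longleftrightarrow> j \<le> multiplicity p m" for j
    using power_dvd_iff_le_multiplicity[of m p j] assms(2) nu by auto
  have "multiplicity p m < n + 1"
  proof -
    have "p ^ multiplicity p m \<le> m" using assms(2) by (intro dvd_imp_le multiplicity_dvd)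
    moreover have "multiplicity p m < p ^ multiplicity p m"
      using prime_gt_1_nat[OF assms(1)] by (intro power_gt_expt) simp
    ultimately show ?thesis using assms(3) by linarith
  qed
  then have "{j\<in>{1..n}. p ^ j dvd m} = {1..multiplicity p m}" unfolding * by auto
  then show ?thesis by simp
qed

text \<open>Legendre's formula, by counting the pairs (m, j) with p^j dividing m in two
  ways.\<close>

lemma multiplicity_fact_eq_sum:
  fixes p n :: nat
  assumes "prime p"
  shows "multiplicity p (fact n) = (\<Sum>j=1..n. n div p ^ j)"
proof -
  have "multiplicity p (fact n :: nat) = multiplicity p (\<Prod>m\<in>{1..n}. m)"
    by (simp add: fact_prod)
  also have "\<dots> = (\<Sum>m\<in>{1..n}. multiplicity p m)"
    using assms by (subst prime_elem_multiplicity_prod_distrib) auto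
  also have "\<dots> = (\<Sum>m\<in>{1..n}. card {j\<in>{1..n}. p ^ j dvd m})"
    using assms by (intro sum.cong refl multiplicity_eq_card) auto
  also have "\<dots> = (\<Sum>m\<in>{1..n}. \<Sum>j\<in>{1..n}. if p ^ j dvd m then 1 else 0)"
    by (simp add: sum.If_cases Int_def)
  also have "\<dots> = (\<Sum>j\<in>{1..n}. \<Sum>m\<in>{1..n}. if p ^ j dvd m then 1 else 0)"
    by (rule sum.swap)
  also have "\<dots> = (\<Sum>j\<in>{1..n}. card {m\<in>{1..n}. p ^ j dvd m})"
    by (simp add: sum.If_cases Int_def)
  also have "\<dots> = (\<Sum>j=1..n. n div p ^ j)"
    using assms by (intro sum.cong refl card_multiples_atMost) (auto simp: prime_gt_0_nat)
  finally show ?thesis .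
qed

lemma ln_fact_eq_sum_primes:
  "ln (fact n) = (\<Sum>p | prime p \<and> p \<le> n. real (multiplicity p (fact n)) * ln (real p))"
proof -
  have pf: "prime_factors (fact n :: nat) = {p. prime p \<and> p \<le> n}"
    by (auto simp: prime_factors_dvd prime_dvd_fact_iff)
  have "(fact n :: real) = real (fact n)" by simp
  also have "(fact n :: nat) = (\<Prod>p\<in>{p. prime p \<and> p \<le> n}. p ^ multiplicity p (fact n))"
    by (subst prime_factorization_nat) (simp_all only: fact_gt_zero pf)
  also have "real \<dots> = (\<Prod>p\<in>{p. prime p \<and> p \<le> n}. real p ^ multiplicity p (fact n))"
    by simp
  also have "ln \<dots> = (\<Sum>p | prime p \<and> p \<le> n. ln (real p ^ multiplicity p (fact n)))"
    by (intro ln_prod) (auto simp: prime_gt_0_nat)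
  also have "\<dots> = (\<Sum>p | prime p \<and> p \<le> n. real (multiplicity p (fact n)) * ln (real p))"
    by (simp add: ln_realpow)
  finally show ?thesis .
qed

lemma ln_fact_le: "ln (fact n :: real) \<le> real n * ln (real n)"
proof (cases "n = 0")
  case False
  have "(fact n :: real) \<le> real n ^ n" using fact_le_power[of n, where 'a = real] by simp
  then have "ln (fact n :: real) \<le> ln (real n ^ n)" by (subst ln_le_cancel_iff) (use False in auto)
  then show ?thesis using False by (simp add: ln_realpow)
qed simp

text \<open>n^n / n! is a single term of the exponential series at n.\<close>

lemma ln_fact_ge: 
  assumes "n \<ge> 1"
  shows "ln (fact n :: real) \<ge> real n * (ln (real n) - 1)"
proof -
  have *: "real n ^ n / fact n \<le> exp (real n)"
  proof -
    have s: "(\<lambda>i. real n ^ i / fact i) sums exp (real n)"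
      using exp_converges[of "real n"] by (simp add: scaleR_conv_of_real field_simps)
    have "(\<Sum>i\<in>{n}. real n ^ i / fact i) \<le> (\<Sum>i. real n ^ i / fact i)"
      by (rule sum_le_suminf) (use s in \<open>auto simp: sums_iff\<close>)
    then show ?thesis using s by (simp add: sums_iff)
  qed
  have "ln (real n ^ n / fact n) \<le> real n"
    using * assms by (subst ln_le_cancel_iff [of _ "exp (real n)", simplified]) auto
  moreover have "ln (real n ^ n / fact n) = real n * ln (real n) - ln (fact n)"
    using assms by (simp add: ln_div ln_realpow)
  ultimately show ?thesis by (simp add: algebra_simps)
qed

text \<open>The exponent of p in n! is at least the integer part of n/p, which is at least half of
  n/p as p <= n; then n! <= n^n. This halving is the origin of the factor 2.\<close>

lemma sum_primes_ln_div_le: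
  "(\<Sum>p | prime p \<and> p \<le> n. ln (real p) / real p) \<le> 2 * ln (real n)"
proof (cases "n = 0")
  case True
  then have "{p::nat. prime p \<and> p \<le> n} = {}" by auto
  then show ?thesis using True by (simp only: sum.empty) simp
next
  case False
  have "real n * (\<Sum>p | prime p \<and> p \<le> n. ln (real p) / real p)
      = (\<Sum>p | prime p \<and> p \<le> n. real n / real p * ln (real p))"
    by (simp add: sum_distrib_left)
  also have "\<dots> \<le> (\<Sum>p | prime p \<and> p \<le> n. 2 * (real (multiplicity p (fact n)) * ln (real p)))"
  proof (intro sum_mono)
    fix p assume p: "p \<in> {p::nat. prime p \<and> p \<le> n}"
    then have p1: "p > 1" "p \<le> n" "prime p" using prime_gt_1_nat by auto
    have d: "n div p \<ge> 1" using p1 div_le_mono[of p n p] by simp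
    have "n < p * (n div p + 1)" using dividend_less_times_div[of p n] p1 by simp
    also have "\<dots> \<le> p * (2 * (n div p))" using d by simp
    finally have "real n \<le> real (p * (2 * (n div p)))" by linarith
    then have "real n / real p \<le> 2 * real (n div p)" using p1 by (simp add: field_simps)
    also have "n div p \<le> multiplicity p (fact n)"
    proof -
      have "n div p = (\<Sum>j\<in>{1}. n div p ^ j)" by simp
      also have "\<dots> \<le> (\<Sum>j=1..n. n div p ^ j)" using False by (intro sum_mono2) auto
      finally show ?thesis using multiplicity_fact_eq_sum p1 by simp
    qed
    finally show "real n / real p * ln (real p) \<le> 2 * (real (multiplicity p (fact n)) * ln (real p))"
      using p1 by (subst mult.assoc [symmetric], intro mult_right_mono) auto
  qed
  also have "\<dots> = 2 * ln (fact n)" unfolding ln_fact_eq_sum_primes by (simp add: sum_distrib_left)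
  also have "\<dots> \<le> real n * (2 * ln (real n))" using ln_fact_le[of n] by simp
  finally show ?thesis using False by (simp add: mult_le_cancel_left)
qed

lemma multiplicity_fact_le:
  fixes p n :: nat
  assumes "prime p"
  shows "real (multiplicity p (fact n)) \<le> 2 * real n / real p"
proof -
  have p: "p \<ge> 2" using assms prime_ge_2_nat by auto
  have "real (multiplicity p (fact n)) = (\<Sum>j=1..n. real (n div p ^ j))"
    by (simp add: multiplicity_fact_eq_sum[OF assms])
  also have "\<dots> \<le> (\<Sum>j=1..n. real n * (1 / real p) ^ j)"
    using of_nat_div_le_of_nat[of n "p ^ _", where 'a = real]
    by (intro sum_mono) (simp add: power_divide)
  also have "\<dots> = real n * (\<Sum>j=1..n. (1 / real p) ^ j)" by (simp add: sum_distrib_left)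
  also have "(\<Sum>j=1..n. (1 / real p) ^ j) = (\<Sum>j=0..<n. (1 / real p) * (1 / real p) ^ j)"
    by (rule sum.reindex_bij_witness[of _ Suc "\<lambda>j. j - 1"]) (auto simp flip: power_Suc)
  also have "\<dots> = (1 / real p) * (\<Sum>j<n. (1 / real p) ^ j)"
    by (simp add: sum_distrib_left atLeast0LessThan)
  also have "real n * ((1 / real p) * (\<Sum>j<n. (1 / real p) ^ j)) \<le> real n * ((1 / real p) * 2)"
  proof (intro mult_left_mono)
    have "(\<Sum>j<n. (1 / real p) ^ j) \<le> (\<Sum>j. (1 / real p) ^ j)"
      by (rule sum_le_suminf) (use p in \<open>auto simp: summable_geometric\<close>)
    also have "\<dots> = 1 / (1 - 1 / real p)" by (rule suminf_geometric) (use p in auto)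
    also have "\<dots> \<le> 2" using p by (simp add: field_simps)
    finally show "(\<Sum>j<n. (1 / real p) ^ j) \<le> 2" .
  qed auto
  finally show ?thesis by (simp add: mult.commute)
qed

text \<open>Here the exponent of p in n! is bounded above by 2n/p, from a geometric series, and n!
  is bounded below by (n/e)^n.\<close>

lemma sum_primes_ln_div_ge:
  assumes "n \<ge> 1"
  shows "2 * (\<Sum>p | prime p \<and> p \<le> n. ln (real p) / real p) \<ge> ln (real n) - 1"
proof -
  have "real n * (ln (real n) - 1) \<le> ln (fact n)" using ln_fact_ge[OF assms] .
  also have "\<dots> \<le> (\<Sum>p | prime p \<and> p \<le> n. 2 * real n / real p * ln (real p))"
    unfolding ln_fact_eq_sum_primes
    by (intro sum_mono mult_right_mono multiplicity_fact_le) (auto intro!: ln_ge_zero dest: prime_ge_1_nat)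
  also have "\<dots> = real n * (2 * (\<Sum>p | prime p \<and> p \<le> n. ln (real p) / real p))"
    by (simp add: sum_distrib_left mult_ac)
  finally show ?thesis using assms by (simp add: mult_le_cancel_left)
qed

text \<open>With L = ln x, the two bounds leave at least (6L - 1)/2 - 2L for the sum of (ln p)/p
  over the interval, and this is at least L/2 since x >= 3 > e gives L >= 1. The exponent must
  exceed 4 for the leading terms not to cancel. Dividing by ln p <= 6L yields 1/12, of which half is
  kept.\<close>

lemma sum_prime_inverse_gap:
  assumes "x \<ge> 3"
  shows "(\<Sum>p | prime p \<and> x < p \<and> p \<le> x ^ 6. 1 / real p) \<ge> 1 / 24"
proof -
  have x: "ln (real x) \<ge> 1"
    using assms exp_le by (subst ln_ge_iff) auto
  have le: "x \<le> x ^ 6" using assms by (simp add: self_le_power)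
  have "6 * ln (real x) - 1 = ln (real (x ^ 6)) - 1" using assms by (simp add: ln_realpow)
  also have "\<dots> \<le> 2 * (\<Sum>p | prime p \<and> p \<le> x ^ 6. ln (real p) / real p)"
    using assms by (intro sum_primes_ln_div_ge) auto
  also have "{p. prime p \<and> p \<le> x ^ 6} = {p. prime p \<and> p \<le> x} \<union> {p. prime p \<and> x < p \<and> p \<le> x ^ 6}"
    using le by auto
  also have "(\<Sum>p\<in>\<dots>. ln (real p) / real p) = (\<Sum>p | prime p \<and> p \<le> x. ln (real p) / real p) +
      (\<Sum>p | prime p \<and> x < p \<and> p \<le> x ^ 6. ln (real p) / real p)"
    by (intro sum.union_disjoint) auto
  also have "\<dots> \<le> 2 * ln (real x) + (\<Sum>p | prime p \<and> x < p \<and> p \<le> x ^ 6. (6 * ln (real x)) * (1 / real p))"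
  proof (intro add_mono sum_primes_ln_div_le sum_mono)
    fix p assume p: "p \<in> {p. prime p \<and> x < p \<and> p \<le> x ^ 6}"
    then have "ln (real p) \<le> ln (real (x ^ 6))" 
      using assms by (subst ln_le_cancel_iff) (auto simp flip: of_nat_power)
    then have "ln (real p) \<le> 6 * ln (real x)" using assms by (simp add: ln_realpow)
    then show "ln (real p) / real p \<le> (6 * ln (real x)) * (1 / real p)"
      by (simp add: divide_right_mono)
  qed
  finally have "1 * ln (real x) \<le> 12 * ln (real x) * (\<Sum>p | prime p \<and> x < p \<and> p \<le> x ^ 6. 1 / real p)"
    using x by (simp add: sum_distrib_left)
  then have "ln (real x) * 1 \<le> ln (real x) * (12 * (\<Sum>p | prime p \<and> x < p \<and> p \<le> x ^ 6. 1 / real p))"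
    by (simp add: mult_ac)
  then have "1 \<le> 12 * (\<Sum>p | prime p \<and> x < p \<and> p \<le> x ^ 6. 1 / real p)"
    by (subst (asm) mult_le_cancel_left_pos) (use x in auto)
  then show ?thesis by linarith
qed

section \<open>Greedy choice of a set of primes\<close>

text \<open>The weights \<open>w\<close> tend to zero, yet every late window from \<open>x\<close>
  to \<open>h x\<close> carries mass at least \<delta>, while the target \<open>t\<close> moves by
  o(1) across it. So the weights are fine enough not to overshoot and plentiful enough to catch
  up.\<close>

locale greedy =
  fixes w t :: "nat \<Rightarrow> real" and h :: "nat \<Rightarrow> nat" and \<delta> :: real
  assumes w_nonneg: "\<And>n. w n \<ge> 0" and w_lim: "w \<longlonglongrightarrow> 0"
    and t_mono: "mono t" and t_lim: "filterlim t at_top sequentially"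
    and h_gt: "\<And>n. h n > n"
    and local_mass: "\<delta> > 0" "eventually (\<lambda>x. sum w {x<..h x} \<ge> \<delta>) sequentially"
    and t_slow: "(\<lambda>x. t (h x) - t x) \<longlonglongrightarrow> 0"
begin

fun s :: "nat \<Rightarrow> real" where
  "s 0 = 0"
| "s (Suc n) = (if s n < t (Suc n) then s n + w (Suc n) else s n)"

definition chosen :: "nat set" where
  "chosen = {n. n > 0 \<and> s (n - 1) < t n}"

lemma s_eq: "s N = sum w (chosen \<inter> {..N})"
proof (induction N)
  case 0
  have "chosen \<inter> {..0} = {}" by (auto simp: chosen_def)
  then show ?case by simp
next
  case (Suc N)
  have "chosen \<inter> {..Suc N} = (if s N < t (Suc N) then insert (Suc N) (chosen \<inter> {..N}) else chosen \<inter> {..N})"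
    by (auto simp: chosen_def le_Suc_eq)
  then show ?case using Suc.IH by (simp add: add.commute)
qed

lemma s_mono: "mono s"
  by (rule incseq_SucI) (simp add: w_nonneg)

text \<open>A weight is added only while the sum is below the target, so each overshoot is at most
  one weight, eventually less than \<epsilon>. The excess built up by the early weights is frozen at
  \<open>s M\<close> and overtaken by \<open>t\<close>.\<close>

lemma upper: 
  assumes "\<epsilon> > 0"
  shows "eventually (\<lambda>n. s n \<le> t n + \<epsilon>) sequentially"
proof -
  obtain M where M: "\<And>n. n \<ge> M \<Longrightarrow> w n < \<epsilon>"
    using order_tendstoD(2)[OF w_lim assms] by (auto simp: eventually_sequentially)
  obtain L where L: "L \<ge> M" "t L \<ge> s M"
    using filterlim_at_top[THEN iffD1, OF t_lim, rule_format, of "s M"]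
    by (metis eventually_sequentially nle_le)
  have "s n \<le> max (s M) (t n + \<epsilon>)" if "n \<ge> M" for n
    using that
  proof (induction n rule: dec_induct)
    case (step n)
    have "t n \<le> t (Suc n)" using t_mono by (simp add: monoD)
    then show ?case using step M[of "Suc n"] by auto
  qed simp
  then have "s n \<le> t n + \<epsilon>" if "n \<ge> L" for n
    using that L monoD[OF t_mono, of L n] assms by (smt (verit) le_trans)
  then show ?thesis by (auto simp: eventually_sequentially)
qed

lemma sum_chosen:
  assumes "x \<le> y" "\<And>n. x \<le> n \<Longrightarrow> n < y \<Longrightarrow> s n < t (Suc n)"
  shows "s y = s x + sum w {x<..y}"
  using assms
proof (induction y rule: dec_induct)
  case (step n)
  then have "{x<..Suc n} = insert (Suc n) {x<..n}" by auto
  then show ?case using step step.prems[of n] by simp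
qed simp

text \<open>While the sum is below the target, every weight is taken, and a full window gains more
  than the target moves. Hence the target is reached at some point, and afterwards the last index
  \<open>x\<close> at which it was reached is never more than one window back; in that window the
  target moved by less than \<epsilon>.\<close>

lemma lower:
  assumes "\<epsilon> > 0"
  shows "eventually (\<lambda>n. s n \<ge> t n - \<epsilon>) sequentially"
proof -
  \<comment> \<open>At most \<delta>/2, so that a window of mass \<delta> reduces a deficit by at
    least \<delta>/2.\<close>
  define e where "e = min \<epsilon> (\<delta> / 2)"
  have e: "e > 0" "e \<le> \<epsilon>" "e \<le> \<delta> / 2" using assms local_mass by (auto simp: e_def)
  have "eventually (\<lambda>x. sum w {x<..h x} \<ge> \<delta> \<and> t (h x) - t x < e \<and> w (Suc x) < \<delta> / 2) sequentially"
    using local_mass order_tendstoD(2)[OF t_slow e(1)]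
      order_tendstoD(2)[OF LIMSEQ_Suc[OF w_lim], of "\<delta> / 2"]
    by (auto intro!: eventually_conj)
  then obtain X where X: "\<And>x. x \<ge> X \<Longrightarrow> sum w {x<..h x} \<ge> \<delta>" 
    "\<And>x. x \<ge> X \<Longrightarrow> t (h x) - t x < e" "\<And>x. x \<ge> X \<Longrightarrow> w (Suc x) < \<delta> / 2"
    by (auto simp: eventually_sequentially)
  obtain x0 where x0: "x0 \<ge> X" "s x0 \<ge> t x0"
  proof (rule ccontr)
    assume "\<not> thesis"
    then have neg: "s n < t n" if "n \<ge> X" for n using that \<open>\<And>x0. \<lbrakk>X \<le> x0; t x0 \<le> s x0\<rbrakk> \<Longrightarrow> thesis\<close>
      by force
    have lt: "s n < t (Suc n)" if "n \<ge> X" for n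
      using neg[OF that] monoD[OF t_mono, of n "Suc n"] by simp
    have ge: "(h ^^ j) X \<ge> X" for j
      by (induction j) (use h_gt in \<open>auto intro: le_trans less_imp_le\<close>)
    have "t ((h ^^ j) X) - s ((h ^^ j) X) \<le> t X - s X - real j * (\<delta> / 2)" for j
    proof (induction j)
      case (Suc j)
      let ?x = "(h ^^ j) X"
      have "s (h ?x) = s ?x + sum w {?x<..h ?x}"
        using h_gt[of ?x] ge[of j] by (intro sum_chosen lt) auto
      moreover have "sum w {?x<..h ?x} \<ge> \<delta>" "t (h ?x) - t ?x < e" using X ge by auto
      ultimately have "t (h ?x) - s (h ?x) \<le> t X - s X - (real j * (\<delta> / 2) + \<delta> / 2)"
        using Suc.IH e by linarith
      moreover have "real (Suc j) * (\<delta> / 2) = real j * (\<delta> / 2) + \<delta> / 2"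
        by (simp add: field_simps)
      ultimately show ?case unfolding funpow.simps o_apply by linarith
    qed simp
    moreover have "t ((h ^^ j) X) - s ((h ^^ j) X) > 0" for j using neg[OF ge] by simp
    ultimately have bd: "real j * (\<delta> / 2) < t X - s X" for j by (smt (verit))
    obtain j :: nat where "t X - s X < real j * (\<delta> / 2)"
      using ex_less_of_nat_mult[of "\<delta> / 2" "t X - s X"] local_mass(1) that by auto
    then show False using bd[of j] by simp
  qed
  have "s y \<ge> t y - \<epsilon>" if "y \<ge> x0" for y
  proof -
    define x where "x = Max {x. x \<le> y \<and> s x \<ge> t x}"
    have fin: "finite {x. x \<le> y \<and> s x \<ge> t x}" by simp
    have "x \<in> {x. x \<le> y \<and> s x \<ge> t x}" unfolding x_def
      by (rule Max_in[OF fin]) (use x0 that in blast)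
    then have x: "x \<le> y" "s x \<ge> t x" by auto
    have x_max: "s z < t z" if "x < z" "z \<le> y" for z
    proof (rule ccontr)
      assume "\<not> s z < t z"
      then have "z \<le> x" unfolding x_def using that(2) by (intro Max_ge[OF fin]) simp
      then show False using that(1) by simp
    qed
    have "x \<ge> x0" using Max_ge[OF fin, of x0] x0 that unfolding x_def by auto
    then have xX: "x \<ge> X" using x0 by simp
    have "y \<le> h x"
    proof (rule ccontr)
      assume "\<not> y \<le> h x"
      then have y: "h x < y" by simp
      \<comment> \<open>The window starts at \<open>Suc x\<close> because the sum has reached the
        target at \<open>x\<close>, so the weight at \<open>Suc x\<close> may have been skipped;
        losing it costs less than \<delta>/2.\<close>
      have "s (h x) = s (Suc x) + sum w {Suc x<..h x}"
      proof (rule sum_chosen)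
        show "Suc x \<le> h x" using h_gt[of x] by simp
        fix n assume "Suc x \<le> n" "n < h x"
        then show "s n < t (Suc n)" 
          using x_max[of n] y monoD[OF t_mono, of n "Suc n"] by simp
      qed
      moreover have "{x<..h x} = insert (Suc x) {Suc x<..h x}" using h_gt[of x] by auto
      then have "sum w {x<..h x} = w (Suc x) + sum w {Suc x<..h x}" by simp
      moreover have "s (Suc x) \<ge> s x" using w_nonneg by simp
      ultimately have "s (h x) \<ge> t x + \<delta> / 2" using X(1,3)[OF xX] x by linarith
      moreover have "s (h x) < t (h x)" using x_max[of "h x"] h_gt[of x] y by simp
      ultimately show False using X(2)[OF xX] e by linarith
    qed
    then have "t y \<le> t (h x)" using t_mono by (simp add: monoD)
    moreover have "s x \<le> s y" using s_mono x by (simp add: monoD)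
    ultimately show ?thesis using X(2)[OF xX] x e by linarith
  qed
  then show ?thesis by (auto simp: eventually_sequentially)
qed

lemma sum_chosen_tendsto: "(\<lambda>N. sum w (chosen \<inter> {..N}) - t N) \<longlonglongrightarrow> 0"
proof (rule tendstoI)
  fix e :: real assume e: "e > 0"
  show "eventually (\<lambda>N. dist (sum w (chosen \<inter> {..N}) - t N) 0 < e) sequentially"
    using eventually_conj[OF upper[of "e/2"] lower[of "e/2"]] e
    by (auto elim!: eventually_mono simp: dist_real_def s_eq)
qed

end

lemma exists_prime_subset:
  fixes t :: "nat \<Rightarrow> real"
  assumes "mono t" "filterlim t at_top sequentially" "(\<lambda>x. t ((x + 3) ^ 6) - t x) \<longlonglongrightarrow> 0"
  shows "\<exists>P \<subseteq> {p. prime p}. (\<lambda>N. (\<Sum>p\<in>P \<inter> {..N}. ln (1 + 1 / real p)) - t N) \<longlonglongrightarrow> 0"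
proof -
  define w :: "nat \<Rightarrow> real" where "w n = (if prime n then ln (1 + 1 / real n) else 0)" for n
  have wbd: "w n \<ge> 0" "w n \<le> 1 / real n" for n
    by (auto simp: w_def ln_add_one_self_le_self prime_gt_0_nat)
  \<comment> \<open>The shift by 3 meets the hypothesis of \<open>sum_prime_inverse_gap\<close> for
    every x. The bound ln (1 + u) >= u/2 for u <= 1/2 halves 1/24 to 1/48.\<close>
  interpret greedy w t "\<lambda>x. (x + 3) ^ 6" "1 / 48"
  proof
    show "w \<longlonglongrightarrow> 0"
      by (rule tendsto_sandwich[OF _ _ tendsto_const lim_1_over_n]) (auto simp: wbd)
    show "n < (n + 3) ^ 6" for n :: nat
    proof -
      have "n < n + 3" by simp
      also have "\<dots> \<le> (n + 3) ^ 6" by (rule self_le_power) auto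
      finally show ?thesis .
    qed
    show "eventually (\<lambda>x. sum w {x<..(x + 3) ^ 6} \<ge> 1 / 48) sequentially"
    proof (rule always_eventually, rule allI)
      fix x :: nat
      have "1 / 48 \<le> (1 / 2) * (\<Sum>p | prime p \<and> x + 3 < p \<and> p \<le> (x + 3) ^ 6. 1 / real p)"
        using sum_prime_inverse_gap[of "x + 3"] by simp
      also have "\<dots> = (\<Sum>p | prime p \<and> x + 3 < p \<and> p \<le> (x + 3) ^ 6. (1 / 2) * (1 / real p))"
        by (simp add: sum_distrib_left)
      also have "\<dots> \<le> (\<Sum>p | prime p \<and> x + 3 < p \<and> p \<le> (x + 3) ^ 6. w p)"
      proof (rule sum_mono)
        fix p assume p: "p \<in> {p. prime p \<and> x + 3 < p \<and> p \<le> (x + 3) ^ 6}"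
        then have p2: "p \<ge> 2" by auto
        have "1 / real p - (1 / real p)\<^sup>2 \<le> ln (1 + 1 / real p)"
          using p2 by (intro ln_one_plus_pos_lower_bound) auto
        moreover have "(1 / real p)\<^sup>2 \<le> (1 / 2) * (1 / real p)"
          using p2 by (simp add: power2_eq_square field_simps)
        ultimately show "(1 / 2) * (1 / real p) \<le> w p" using p by (simp add: w_def)
      qed
      also have "\<dots> \<le> sum w {x<..(x + 3) ^ 6}"
        by (rule sum_mono2) (use wbd in auto)
      finally show "1 / 48 \<le> sum w {x<..(x + 3) ^ 6}" .
    qed
  qed (use assms wbd in auto)
  have "(\<Sum>p\<in>(chosen \<inter> {p. prime p}) \<inter> {..N}. ln (1 + 1 / real p)) = sum w (chosen \<inter> {..N})" for N
    by (rule sum.mono_neutral_cong_left) (auto simp: w_def)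
  then show ?thesis using sum_chosen_tendsto by (intro exI[of _ "chosen \<inter> {p. prime p}"]) auto
qed

section \<open>Sums over squarefree numbers\<close>

lemma squarefree_dvd:
  fixes a b :: nat
  assumes "squarefree b" "a dvd b"
  shows "squarefree a"
  using assms by (meson dvd_trans squarefree_def)

definition sqfree_over :: "nat set \<Rightarrow> nat set" where
  "sqfree_over P = {n. n > 0 \<and> squarefree n \<and> prime_factors n \<subseteq> P}"

lemma sqfree_over_empty: "sqfree_over {} = {1}"
  by (auto simp: sqfree_over_def prime_factorization_empty_iff)

lemma sqfree_over_dvd: "n \<in> sqfree_over P \<Longrightarrow> d dvd n \<Longrightarrow> d \<in> sqfree_over P"
  unfolding sqfree_over_def by (auto intro: squarefree_dvd dvd_pos_nat dest: dvd_prime_factors[rotated])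

lemma sqfree_over_insert:
  assumes "prime p" "p \<notin> Q"
  shows "sqfree_over (insert p Q) = sqfree_over Q \<union> (*) p ` sqfree_over Q"
    and "sqfree_over Q \<inter> (*) p ` sqfree_over Q = {}"
proof -
  show "sqfree_over Q \<inter> (*) p ` sqfree_over Q = {}"
  proof -
    have "p * m \<notin> sqfree_over Q" for m
    proof
      assume m: "p * m \<in> sqfree_over Q"
      then have "p \<in> prime_factors (p * m)"
        using assms(1) by (auto simp: sqfree_over_def in_prime_factors_iff)
      then show False using m assms(2) by (auto simp: sqfree_over_def)
    qed
    then show ?thesis by blast
  qed
  show "sqfree_over (insert p Q) = sqfree_over Q \<union> (*) p ` sqfree_over Q"
  proof (intro subset_antisym subsetI)
    fix n assume n: "n \<in> sqfree_over (insert p Q)"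
    show "n \<in> sqfree_over Q \<union> (*) p ` sqfree_over Q"
    proof (cases "p dvd n")
      case True
      then obtain m where m: "n = p * m" by blast
      have mI: "m \<in> sqfree_over (insert p Q)" using sqfree_over_dvd[OF n] m by simp
      have "\<not> p dvd m"
      proof
        assume "p dvd m"
        then have "p\<^sup>2 dvd n" unfolding m power2_eq_square by simp
        then have "is_unit p" using n unfolding sqfree_over_def squarefree_def by blast
        then show False using assms by simp
      qed
      then have "m \<in> sqfree_over Q" using mI by (auto simp: sqfree_over_def prime_factors_dvd)
      then show ?thesis using m by auto
    next
      case False
      then have "n \<in> sqfree_over Q" using n by (auto simp: sqfree_over_def prime_factors_dvd)
      then show ?thesis by simp
    qed
  next
    fix n assume "n \<in> sqfree_over Q \<union> (*) p ` sqfree_over Q"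
    then show "n \<in> sqfree_over (insert p Q)"
    proof
      assume "n \<in> (*) p ` sqfree_over Q"
      then obtain m where m: "n = p * m" "m \<in> sqfree_over Q" by blast
      have "\<not> p dvd m" using m(2) assms by (auto simp: sqfree_over_def prime_factors_dvd)
      then have "coprime p m" using assms by (simp add: prime_imp_coprime)
      then have "squarefree n"
        using m assms by (auto simp: sqfree_over_def squarefree_mult_coprime squarefree_prime)
      then show ?thesis using m assms
        by (auto simp: sqfree_over_def prime_factors_dvd prime_gt_0_nat prime_dvd_mult_iff primes_dvd_imp_eq)
    qed (auto simp: sqfree_over_def)
  qed
qed

text \<open>Induction on the prime set, splitting numbers by divisibility by the new prime. The last
  bound is a logarithmic derivative of the Euler product: the exact value would have (ln p) / (p +
  1) in place of (ln p) / p.\<close>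

lemma
  assumes "finite Q" "Q \<subseteq> {p. prime p}"
  shows finite_sqfree_over: "finite (sqfree_over Q)"
    and sum_inverse_sqfree_over: "(\<Sum>n\<in>sqfree_over Q. 1 / real n) = (\<Prod>p\<in>Q. 1 + 1 / real p)"
    and sum_ln_div_sqfree_over: "(\<Sum>n\<in>sqfree_over Q. ln (real n) / real n)
      \<le> (\<Prod>p\<in>Q. 1 + 1 / real p) * (\<Sum>p\<in>Q. ln (real p) / real p)"
proof -
  have "finite (sqfree_over Q) \<and> (\<Sum>n\<in>sqfree_over Q. 1 / real n) = (\<Prod>p\<in>Q. 1 + 1 / real p) \<and>
    (\<Sum>n\<in>sqfree_over Q. ln (real n) / real n)
      \<le> (\<Prod>p\<in>Q. 1 + 1 / real p) * (\<Sum>p\<in>Q. ln (real p) / real p)"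
    using assms
  proof (induction Q rule: finite_induct)
    case empty
    then show ?case by (simp add: sqfree_over_empty)
  next
    case (insert p Q)
    let ?F = "\<Prod>p\<in>Q. 1 + 1 / real p"
    let ?L = "\<Sum>n\<in>sqfree_over Q. ln (real n) / real n"
    have p: "prime p" "real p > 1" using insert.prems prime_gt_1_nat by auto
    have IH: "finite (sqfree_over Q)" "(\<Sum>n\<in>sqfree_over Q. 1 / real n) = ?F"
      "?L \<le> ?F * (\<Sum>p\<in>Q. ln (real p) / real p)" using insert by auto
    have inj: "inj_on ((*) p) (sqfree_over Q)" using p by (auto simp: inj_on_def)
    have split: "(\<Sum>n\<in>sqfree_over (insert p Q). f n) = 
        (\<Sum>n\<in>sqfree_over Q. f n) + (\<Sum>n\<in>sqfree_over Q. f (p * n))" for f :: "nat \<Rightarrow> real"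
      using sqfree_over_insert[OF p(1) insert.hyps(2)] IH(1) inj
      by (simp add: sum.union_disjoint sum.reindex)
    have "(\<Sum>n\<in>sqfree_over (insert p Q). 1 / real n) = ?F + (1 / real p) * (\<Sum>n\<in>sqfree_over Q. 1 / real n)"
      unfolding split sum_distrib_left by (simp add: IH(2))
    then have 1: "(\<Sum>n\<in>sqfree_over (insert p Q). 1 / real n) = (1 + 1 / real p) * ?F"
      by (simp add: IH algebra_simps)
    have "(\<Sum>n\<in>sqfree_over Q. ln (real (p * n)) / real (p * n)) =
       (\<Sum>n\<in>sqfree_over Q. (ln (real p) / real p) * (1 / real n) + (1 / real p) * (ln (real n) / real n))"
      using p by (intro sum.cong refl) (auto simp: sqfree_over_def ln_mult field_simps)
    also have "\<dots> = (ln (real p) / real p) * ?F + (1 / real p) * ?L"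
      unfolding sum.distrib sum_distrib_left [symmetric] IH(2) ..
    finally have "(\<Sum>n\<in>sqfree_over (insert p Q). ln (real n) / real n)
        = (1 + 1 / real p) * ?L + (ln (real p) / real p) * ?F"
      by (simp add: split algebra_simps)
    also have "\<dots> \<le> (1 + 1 / real p) * (?F * (\<Sum>p\<in>Q. ln (real p) / real p)) + 
        (1 + 1 / real p) * ((ln (real p) / real p) * ?F)"
    proof (intro add_mono mult_left_mono IH)
      have "?F \<ge> 0" by (intro prod_nonneg) auto
      then have "0 \<le> (ln (real p) / real p) * ?F" using p by simp
      then have "1 * ((ln (real p) / real p) * ?F) \<le> (1 + 1 / real p) * ((ln (real p) / real p) * ?F)"
        by (intro mult_right_mono) auto
      then show "(ln (real p) / real p) * ?F \<le> (1 + 1 / real p) * ((ln (real p) / real p) * ?F)" by simp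
    qed auto
    also have "\<dots> = ((1 + 1 / real p) * ?F) * (ln (real p) / real p + (\<Sum>p\<in>Q. ln (real p) / real p))"
    proof -
      have "(1 + a) * (f * c) + (1 + a) * (b * f) = ((1 + a) * f) * (b + c)" for a b c f :: real
        by (simp add: algebra_simps)
      then show ?thesis .
    qed
    finally show ?case using 1 insert.hyps IH(1) sqfree_over_insert[OF p(1) insert.hyps(2)] by simp
  qed
  then show "finite (sqfree_over Q)" "(\<Sum>n\<in>sqfree_over Q. 1 / real n) = (\<Prod>p\<in>Q. 1 + 1 / real p)"
    "(\<Sum>n\<in>sqfree_over Q. ln (real n) / real n)
      \<le> (\<Prod>p\<in>Q. 1 + 1 / real p) * (\<Sum>p\<in>Q. ln (real p) / real p)" by auto
qed

lemma sum_sqfree_over_upto_le: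
  assumes "P \<subseteq> {p. prime p}"
  shows "(\<Sum>n\<in>sqfree_over P \<inter> {..N}. 1 / real n) \<le> (\<Prod>p\<in>P \<inter> {..N}. 1 + 1 / real p)"
proof -
  have Q: "finite (P \<inter> {..N})" "P \<inter> {..N} \<subseteq> {p. prime p}" using assms by auto
  have "sqfree_over P \<inter> {..N} \<subseteq> sqfree_over (P \<inter> {..N})"
    by (auto simp: sqfree_over_def prime_factors_dvd dest: dvd_imp_le intro: le_trans)
  then have "(\<Sum>n\<in>sqfree_over P \<inter> {..N}. 1 / real n) \<le> (\<Sum>n\<in>sqfree_over (P \<inter> {..N}). 1 / real n)"
    using finite_sqfree_over[OF Q] by (intro sum_mono2) auto
  then show ?thesis using sum_inverse_sqfree_over[OF Q] by simp
qed

text \<open>The terms of \<open>sqfree_over (P \<inter> {..y})\<close> beyond \<open>N\<close> are weighted by \<open>ln n / ln N \<ge> 1\<close>.\<close>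

lemma sum_sqfree_over_upto_ge:
  assumes "P \<subseteq> {p. prime p}" "N > 1"
  shows "(\<Sum>n\<in>sqfree_over P \<inter> {..N}. 1 / real n) \<ge>
    (\<Prod>p\<in>P \<inter> {..y}. 1 + 1 / real p) * (1 - 2 * ln (real y) / ln (real N))"
proof -
  define Q where "Q = P \<inter> {..y}"
  let ?F = "\<Prod>p\<in>Q. 1 + 1 / real p"
  have Q: "finite Q" "Q \<subseteq> {p. prime p}" using assms by (auto simp: Q_def)
  have lnN: "ln (real N) > 0" using assms by simp
  have F: "?F \<ge> 0" by (intro prod_nonneg) auto
  have "(\<Sum>p\<in>Q. ln (real p) / real p) \<le> (\<Sum>p | prime p \<and> p \<le> y. ln (real p) / real p)"
    using assms(1) prime_ge_1_nat by (intro sum_mono2) (auto simp: Q_def intro!: divide_nonneg_nonneg ln_ge_zero)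
  also have "\<dots> \<le> 2 * ln (real y)" by (rule sum_primes_ln_div_le)
  finally have "?F * (\<Sum>p\<in>Q. ln (real p) / real p) \<le> ?F * (2 * ln (real y))"
    using F by (rule mult_left_mono)
  then have L: "(\<Sum>n\<in>sqfree_over Q. ln (real n) / real n) \<le> ?F * (2 * ln (real y))"
    using sum_ln_div_sqfree_over[OF Q] by simp
  have "?F * (1 - 2 * ln (real y) / ln (real N)) = ?F - (?F * (2 * ln (real y))) / ln (real N)"
    by (simp add: algebra_simps)
  also have "\<dots> \<le> ?F - (\<Sum>n\<in>sqfree_over Q. ln (real n) / real n) / ln (real N)"
    using L lnN by (simp add: divide_right_mono)
  also have "\<dots> = (\<Sum>n\<in>sqfree_over Q. 1 / real n * (1 - ln (real n) / ln (real N)))"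
    unfolding sum_inverse_sqfree_over[OF Q, symmetric]
    by (simp add: sum_divide_distrib sum_subtractf algebra_simps)
  also have "\<dots> \<le> (\<Sum>n\<in>sqfree_over Q. if n \<le> N then 1 / real n else 0)"
  proof (rule sum_mono)
    fix n assume "n \<in> sqfree_over Q"
    then have n: "n \<ge> 1" by (auto simp: sqfree_over_def)
    show "1 / real n * (1 - ln (real n) / ln (real N)) \<le> (if n \<le> N then 1 / real n else 0)"
    proof (cases "n \<le> N")
      case True
      have "1 - ln (real n) / ln (real N) \<le> 1" using n lnN by simp
      then show ?thesis using True mult_left_mono[of _ 1 "1 / real n"] by simp
    next
      case False
      then have "ln (real n) \<ge> ln (real N)" using assms by simp
      then have "1 - ln (real n) / ln (real N) \<le> 0" using lnN by simp
      then show ?thesis using False mult_left_mono[of _ 0 "1 / real n"] by simp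
    qed
  qed
  also have "\<dots> = (\<Sum>n\<in>sqfree_over Q \<inter> {..N}. 1 / real n)"
    using finite_sqfree_over[OF Q] by (simp add: sum.If_cases Int_def)
  also have "\<dots> \<le> (\<Sum>n\<in>sqfree_over P \<inter> {..N}. 1 / real n)"
    by (intro sum_mono2) (auto simp: sqfree_over_def Q_def)
  finally show ?thesis by (simp add: Q_def)
qed

lemma exists_sqfree_over_asymp:
  fixes r :: nat and k :: real
  assumes "k > 0" "r \<ge> 1"
  shows "\<exists>P \<subseteq> {p. prime p}. (\<lambda>N. \<Sum>n\<in>sqfree_over P \<inter> {..N}. 1 / real n)
    \<sim>[sequentially] (\<lambda>N. k * ln (ln (real N)) ^ r)"
proof -
  \<comment> \<open>The shift makes \<open>l\<close> positive at every index, so that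
    \<open>t\<close> below, the logarithm of the target k l^r, is monotone from the start.\<close>
  define l :: "nat \<Rightarrow> real" where "l N = ln (ln (real N + 16))" for N
  define t where "t N = ln k + real r * ln (l N)" for N
  have ln16: "ln (real N + 16) > 1" for N
  proof -
    have "exp 1 < real N + 16" using exp_le by (simp add: less_le_trans le_less_trans)
    then have "ln (exp 1) < ln (real N + 16)" by (subst ln_less_cancel_iff) auto
    then show ?thesis by simp
  qed
  have l_pos: "l N > 0" for N unfolding l_def using ln16[of N] by simp
  have "mono t"
  proof (rule monoI)
    fix a b :: nat assume ab: "a \<le> b"
    then have "l a \<le> l b" unfolding l_def using ln16[of a] by simp
    then show "t a \<le> t b" unfolding t_def using l_pos[of a] by (simp add: mult_left_mono)
  qed
  moreover have "filterlim t at_top sequentially"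
  proof -
    have "filterlim (\<lambda>N. ln (l N)) at_top sequentially" unfolding l_def by real_asymp
    then show ?thesis unfolding t_def using assms
      by (intro filterlim_tendsto_add_at_top[OF tendsto_const]
          filterlim_tendsto_pos_mult_at_top[OF tendsto_const]) auto
  qed
  moreover have "(\<lambda>x. t ((x + 3) ^ 6) - t x) \<longlonglongrightarrow> 0"
  proof -
    have "(\<lambda>x. ln (l ((x + 3) ^ 6)) - ln (l x)) \<longlonglongrightarrow> 0" unfolding l_def by real_asymp
    from tendsto_mult_right_zero[OF this, of "real r"]
    show ?thesis unfolding t_def by (simp add: algebra_simps)
  qed
  ultimately obtain P where P: "P \<subseteq> {p. prime p}"
    "(\<lambda>N. (\<Sum>p\<in>P \<inter> {..N}. ln (1 + 1 / real p)) - t N) \<longlonglongrightarrow> 0"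
    using exists_prime_subset by blast
  define F where "F N = (\<Prod>p\<in>P \<inter> {..N}. 1 + 1 / real p)" for N
  define G where "G N = (\<Sum>n\<in>sqfree_over P \<inter> {..N}. 1 / real n)" for N
  \<comment> \<open>N^(1 / ln ln N) is small enough that ln y / ln N tends to 0, which removes the
    loss in \<open>sum_sqfree_over_upto_ge\<close>, and large enough that ln ln y is asymptotic to
    ln ln N, which leaves the Euler product asymptotically unchanged.\<close>
  define y :: "nat \<Rightarrow> nat" where "y N = nat \<lfloor>exp (ln (real N) / ln (ln (real N)))\<rfloor>" for N
  have F_pos: "F N > 0" for N unfolding F_def by (intro prod_pos) (auto simp: add_pos_nonneg)
  have "F N = exp (\<Sum>p\<in>P \<inter> {..N}. ln (1 + 1 / real p))" for N
  proof -
    have "exp (ln (1 + 1 / real p)) = 1 + 1 / real p" for p :: nat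
      by (rule exp_ln) (auto simp: add_pos_nonneg)
    then show ?thesis unfolding F_def by (subst exp_sum) auto
  qed
  then have Ft: "F N / (k * l N ^ r) = exp ((\<Sum>p\<in>P \<inter> {..N}. ln (1 + 1 / real p)) - t N)" for N
    using assms l_pos[of N] by (simp add: exp_diff t_def exp_add exp_of_nat_mult)
  have F1: "(\<lambda>N. F N / (k * l N ^ r)) \<longlonglongrightarrow> 1"
    unfolding Ft using tendsto_exp[OF P(2)] by simp
  have y_top: "filterlim y at_top sequentially"
    unfolding y_def by real_asymp
  have l_y: "(\<lambda>N. l (y N) / l N) \<longlonglongrightarrow> 1"
    unfolding l_def y_def by real_asymp
  have ln_y: "(\<lambda>N. ln (real (y N)) / ln (real N)) \<longlonglongrightarrow> 0"
    unfolding y_def by real_asymp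
  have Fy: "(\<lambda>N. F (y N) / F N) \<longlonglongrightarrow> 1"
  proof -
    have lim: "(\<lambda>N. F (y N) / (k * l (y N) ^ r) * (l (y N) / l N) ^ r / (F N / (k * l N ^ r))) \<longlonglongrightarrow> 1 * 1 ^ r / 1"
      by (intro tendsto_intros F1 l_y filterlim_compose[OF F1 y_top]) auto
    have eq: "F (y N) / (k * l (y N) ^ r) * (l (y N) / l N) ^ r / (F N / (k * l N ^ r)) = F (y N) / F N" for N
      using l_pos[of N] l_pos[of "y N"] assms F_pos[of N] by (simp add: power_divide field_simps)
    show ?thesis using lim unfolding eq by simp
  qed
  have "(\<lambda>N. G N / F N) \<longlonglongrightarrow> 1"
  proof (rule tendsto_sandwich)
    show "eventually (\<lambda>N. F (y N) / F N * (1 - 2 * (ln (real (y N)) / ln (real N))) \<le> G N / F N) sequentially"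
      using eventually_gt_at_top[of 1]
    proof eventually_elim
      case (elim N)
      then have "F (y N) * (1 - 2 * ln (real (y N)) / ln (real N)) / F N \<le> G N / F N"
        using sum_sqfree_over_upto_ge[OF P(1) elim, of "y N"] F_pos[of N]
        by (intro divide_right_mono) (auto simp: F_def G_def)
      then show ?case by simp
    qed
    show "eventually (\<lambda>N. G N / F N \<le> 1) sequentially"
      using sum_sqfree_over_upto_le[OF P(1)] F_pos by (auto simp: F_def G_def)
    have "(\<lambda>N. F (y N) / F N * (1 - 2 * (ln (real (y N)) / ln (real N)))) \<longlonglongrightarrow> 1 * (1 - 2 * 0)"
      by (intro tendsto_intros Fy ln_y)
    then show "(\<lambda>N. F (y N) / F N * (1 - 2 * (ln (real (y N)) / ln (real N)))) \<longlonglongrightarrow> 1" by simp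
  qed auto
  from tendsto_mult[OF this F1] have "(\<lambda>N. G N / (k * l N ^ r)) \<longlonglongrightarrow> 1"
    using F_pos by (simp add: less_imp_neq[symmetric])
  then have "G \<sim>[sequentially] (\<lambda>N. k * l N ^ r)"
    by (rule asymp_equivI')
  also have "(\<lambda>N. k * l N ^ r) \<sim>[sequentially] (\<lambda>N. k * ln (ln (real N)) ^ r)"
  proof (intro asymp_equiv_intros)
    show "l \<sim>[sequentially] (\<lambda>N. ln (ln (real N)))" unfolding l_def by real_asymp
  qed
  finally show ?thesis using P(1) unfolding G_def by blast
qed

section \<open>Excluded primes\<close>

text \<open>\<open>ord 2 2\<close> is 0, so the prime 2 is always excluded. This is harmless, as 2^n
  - 1 is odd for n > 0.\<close>

definition excluded_primes :: "nat set \<Rightarrow> nat set" where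
  "excluded_primes P = {p. prime p \<and> ord p 2 \<notin> sqfree_over P}"

lemma prime_dvd_two_power_minus_1_iff:
  fixes p n :: nat
  shows "p dvd 2 ^ n - 1 \<longleftrightarrow> ord p 2 dvd n"
proof -
  have "[2 ^ n = 1] (mod p) \<longleftrightarrow> p dvd 2 ^ n - (1 :: nat)"
    by (rule cong_altdef_nat) simp
  then show ?thesis using ord_divides[of 2 n p] by blast
qed

lemma excluded_primes_not_dvd:
  assumes "n \<in> sqfree_over P" "p \<in> excluded_primes P"
  shows "\<not> p dvd 2 ^ n - 1"
  using assms sqfree_over_dvd[OF assms(1)]
  unfolding excluded_primes_def prime_dvd_two_power_minus_1_iff by blast

text \<open>The condition on \<open>d\<close> says that \<open>d\<close> contains the full power of \<open>q\<close> dividing \<open>n\<close>.\<close>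

lemma not_sqfree_over_obtain_prime:
  assumes "n > 0" "n \<notin> sqfree_over P"
  obtains q where "prime q" "q dvd n" "\<And>d. d dvd n \<Longrightarrow> \<not> d dvd n div q \<Longrightarrow> d \<notin> sqfree_over P"
proof -
  have full: "q dvd d" if "prime q" "q dvd n" "d dvd n" "\<not> d dvd n div q" for q d
  proof (rule ccontr)
    assume "\<not> q dvd d"
    then have "coprime d q" using that by (metis coprime_commute prime_imp_coprime)
    moreover have "d dvd q * (n div q)" using that by simp
    ultimately show False using that using coprime_dvd_mult_right_iff[of d q "n div q"] by simp
  qed
  \<comment> \<open>In the first case q divides \<open>d\<close> although it lies outside
    \<open>P\<close>; in the second even the square of q divides \<open>d\<close>. Either way
    \<open>d\<close> is not admissible.\<close>
  consider q where "prime q" "q dvd n" "q \<notin> P" | q where "prime q" "q\<^sup>2 dvd n"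
  proof (cases "squarefree n")
    case True
    then obtain q where "q \<in> prime_factors n" "q \<notin> P" using assms by (auto simp: sqfree_over_def)
    then show ?thesis using that by (auto simp: in_prime_factors_iff)
  next
    case False
    then show ?thesis using that assms by (auto simp: squarefree_factorial_semiring)
  qed
  then show ?thesis
  proof cases
    case 1
    show ?thesis
    proof (rule that[OF 1(1,2)])
      fix d assume "d dvd n" "\<not> d dvd n div q"
      then have "q dvd d" "d > 0" using full 1 assms dvd_pos_nat by auto
      then show "d \<notin> sqfree_over P" using 1 by (auto simp: sqfree_over_def in_prime_factors_iff)
    qed
  next
    case 2
    then have qn: "q dvd n" by (meson dvd_trans dvd_triv_left power2_eq_square dvd_refl dvd_power zero_less_numeral)
    show ?thesis
    proof (rule that[OF 2(1) qn])
      fix d assume d: "d dvd n" "\<not> d dvd n div q"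
      then obtain e where e: "d = q * e" using full 2 qn by blast
      obtain m where m: "n = q * (q * m)" using 2 by (auto simp: power2_eq_square mult.assoc)
      have q0: "q > 0" using 2 by (simp add: prime_gt_0_nat)
      have "e dvd q * m" "\<not> q * e dvd q * m" using d q0 unfolding e m by auto
      then have "e dvd q * m" "\<not> e dvd m" using q0 by auto
      then have "q dvd e" using 2(1) by (metis coprime_commute coprime_dvd_mult_right_iff prime_imp_coprime)
      then have "q\<^sup>2 dvd d" unfolding e power2_eq_square by simp
      then have "\<not> squarefree d" using 2(1) by (auto simp: squarefree_def)
      then show "d \<notin> sqfree_over P" by (simp add: sqfree_over_def)
    qed
  qed
qed

text \<open>The sum is ((1 + a)^q - 1) / a. Modulo q^2 only the linear terms of the powers survive,
  and they add up to a q (q - 1) / 2, divisible by q^2 because q is odd. This is the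
  lifting-the-exponent argument that keeps q^2 out of the cofactor.\<close>

lemma sum_power_mod_square:
  fixes a q :: nat
  assumes "odd q" "q dvd a"
  shows "[(\<Sum>i<q. (1 + a) ^ i) = q] (mod q\<^sup>2)"
proof -
  have "[(1 + a) ^ i = 1 + i * a] (mod q\<^sup>2)" for i
  proof (induction i)
    case (Suc i)
    have "q\<^sup>2 dvd a\<^sup>2" using assms by simp
    then have "[i * a\<^sup>2 = 0] (mod q\<^sup>2)" by (simp add: cong_0_iff)
    then have "[1 + Suc i * a + i * a\<^sup>2 = 1 + Suc i * a + 0] (mod q\<^sup>2)"
      by (intro cong_add cong_refl)
    moreover have "[(1 + a) ^ i * (1 + a) = (1 + i * a) * (1 + a)] (mod q\<^sup>2)"
      by (intro cong_mult Suc.IH cong_refl)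
    ultimately show ?case by (simp add: algebra_simps power2_eq_square cong_trans)
  qed simp
  then have "[(\<Sum>i<q. (1 + a) ^ i) = (\<Sum>i<q. 1 + i * a)] (mod q\<^sup>2)"
    by (intro cong_sum)
  also have "(\<Sum>i<q. 1 + i * a) = q + a * (\<Sum>i<q. i)"
    by (simp add: sum_Suc sum_distrib_left mult.commute)
  also have "[q + a * (\<Sum>i<q. i) = q + 0] (mod q\<^sup>2)"
  proof (intro cong_add cong_refl)
    have "q dvd (\<Sum>i<q. i)"
    proof -
      have "2 * (\<Sum>i<q. i) = q * (q - 1)" by (induction q) (auto simp: algebra_simps)
      then have "q dvd 2 * (\<Sum>i<q. i)" by simp
      then show ?thesis using assms(1) by (simp add: coprime_dvd_mult_right_iff)
    qed
    then show "[a * (\<Sum>i<q. i) = 0] (mod q\<^sup>2)"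
      using assms unfolding cong_0_iff power2_eq_square by (simp add: mult_dvd_mono)
  qed
  finally show ?thesis by simp
qed

lemma dvd_prime_if_prime_divisors:
  fixes d q :: nat
  assumes "prime q" "d > 0" "\<And>p. prime p \<Longrightarrow> p dvd d \<Longrightarrow> p = q" "\<not> q\<^sup>2 dvd d"
  shows "d dvd q"
proof (cases "d = 1")
  case False
  then obtain p where "prime p" "p dvd d" using prime_factor_nat by blast
  then have "q dvd d" using assms(3) by blast
  then obtain e where e: "d = q * e" by blast
  have "e = 1"
  proof (rule ccontr)
    assume "e \<noteq> 1"
    then obtain p where "prime p" "p dvd e" using prime_factor_nat by blast
    then have "q dvd e" using assms(3)[of p] e by auto
    then show False using assms(4) e by (simp add: power2_eq_square)
  qed
  then show ?thesis using e by simp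
qed simp

text \<open>The cofactor of \<open>2 ^ (n / q) - 1\<close> in \<open>2 ^ n - 1\<close> is composed of excluded primes, except
  for a possible single factor \<open>q\<close>.\<close>

lemma dvd_two_power_minus_1_le:
  fixes m n :: nat
  assumes "n > 0" "n \<notin> sqfree_over P" "m dvd 2 ^ n - 1" "\<And>p. prime p \<Longrightarrow> p dvd m \<Longrightarrow> p \<notin> excluded_primes P"
  shows "m \<le> n * 2 ^ (n div 2)"
proof -
  obtain q where q: "prime q" "q dvd n" "\<And>d. d dvd n \<Longrightarrow> \<not> d dvd n div q \<Longrightarrow> d \<notin> sqfree_over P"
    using not_sqfree_over_obtain_prime[OF assms(1,2)] by blast
  define e where "e = n div q"
  have n: "n = e * q" "e > 0" using q assms(1) by (auto simp: e_def)
  define a :: nat where "a = 2 ^ e - 1"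
  define b :: nat where "b = (\<Sum>i<q. (1 + a) ^ i)"
  have a: "1 + a = 2 ^ e" "a > 0"
    using n one_less_power[of "2 :: nat" e] by (auto simp: a_def)
  have "int (2 ^ n - 1) = int (a * b)"
  proof -
    have "int a * (\<Sum>i<q. (1 + int a) ^ i) = (1 + int a) ^ q - 1"
      using power_diff_1_eq[of "1 + int a" q] by simp
    moreover have "(1 + int a) ^ q = 2 ^ n"
    proof -
      have "1 + int a = 2 ^ e" using a(1) by (metis of_nat_1 of_nat_add of_nat_numeral of_nat_power)
      then show ?thesis by (simp add: n power_mult)
    qed
    ultimately show ?thesis by (simp add: b_def of_nat_diff)
  qed
  then have ab: "2 ^ n - 1 = a * b" by linarith
  have m0: "m > 0"
    using one_less_power[of "2 :: nat" n] assms(1) by (intro dvd_pos_nat[OF _ assms(3)]) simp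
  \<comment> \<open>A prime that is not excluded has admissible order; the choice of q forces this
    order to divide n/q.\<close>
  have dvd_a: "p dvd a" if p: "prime p" "p dvd gcd m b" for p
  proof -
    have "ord p 2 \<in> sqfree_over P" using p assms(4)[of p] by (auto simp: excluded_primes_def)
    moreover have "p dvd 2 ^ n - 1" using p assms(3) by (meson dvd_trans gcd_dvd1)
    then have "ord p 2 dvd n" unfolding prime_dvd_two_power_minus_1_iff .
    ultimately have "ord p 2 dvd e" using q(3) by (auto simp: e_def)
    then show ?thesis unfolding a_def prime_dvd_two_power_minus_1_iff .
  qed
  \<comment> \<open>A common prime p divides \<open>a\<close>, and modulo such p each of the q
    summands of \<open>b\<close> is 1, so p divides q.\<close>
  have "gcd m b dvd q"
  proof (rule dvd_prime_if_prime_divisors[OF q(1)])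
    fix p assume p: "prime p" "p dvd gcd m b"
    then have "p dvd a" by (rule dvd_a)
    then have "[1 + a = 1 + 0] (mod p)" by (intro cong_add) (auto simp: cong_0_iff)
    then have "[(\<Sum>i<q. (1 + a) ^ i) = (\<Sum>i<q. (1 + 0) ^ i)] (mod p)"
      by (intro cong_sum cong_pow)
    then have "[b = q] (mod p)" by (simp add: b_def)
    moreover have "p dvd b" using p by (meson dvd_trans gcd_dvd2)
    ultimately have "p dvd q" using cong_dvd_iff by blast
    then show "p = q" using p(1) q(1) by (simp add: primes_dvd_imp_eq)
  next
    show "\<not> q\<^sup>2 dvd gcd m b"
    proof
      assume qg: "q\<^sup>2 dvd gcd m b"
      then have qb: "q\<^sup>2 dvd b" by simp
      then have qd: "q dvd b" by (metis dvd_mult_left power2_eq_square)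
      then have "odd q"
      proof -
        have "q dvd 2 ^ n - 1" using qd ab by simp
        moreover have "odd (2 ^ n - 1 :: nat)" using assms(1) by simp
        ultimately show ?thesis by (meson dvd_trans)
      qed
      moreover have "q dvd a"
        using dvd_a[OF q(1)] qg by (meson dvd_trans dvd_triv_left power2_eq_square dvd_power zero_less_numeral)
      ultimately have "[b = q] (mod q\<^sup>2)" unfolding b_def by (rule sum_power_mod_square)
      then have "q\<^sup>2 dvd q" using qb cong_dvd_iff by blast
      then have "q\<^sup>2 \<le> q" using q(1) by (intro dvd_imp_le) (auto simp: prime_gt_0_nat)
      then show False using prime_gt_1_nat[OF q(1)] by (simp add: power2_eq_square)
    qed
  qed (use m0 in auto)
  moreover have "m dvd a * gcd m b"
  proof -
    have "m dvd gcd (a * m) (a * b)" using assms(3) ab by simp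
    then show ?thesis by (simp add: gcd_mult_distrib_nat)
  qed
  ultimately have "m dvd a * q" by (meson dvd_trans mult_dvd_mono dvd_refl)
  then have "m \<le> a * q" using a q(1) by (intro dvd_imp_le) (auto simp: prime_gt_0_nat)
  also have "\<dots> \<le> 2 ^ (n div 2) * n"
  proof (rule mult_mono)
    have "e * 2 \<le> n" using n prime_ge_2_nat[OF q(1)] by simp
    then have "(2::nat) ^ e \<le> 2 ^ (n div 2)" by (intro power_increasing) auto
    then show "a \<le> 2 ^ (n div 2)" unfolding a_def by linarith
    show "q \<le> n" using q(2) assms(1) by (rule dvd_imp_le)
  qed auto
  finally show ?thesis by (simp add: mult.commute)
qed

section \<open>Orbit growth\<close>

text \<open>The factor m' is \<open>m\<close> multiplied by its p-adic absolute values for p in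
  \<open>S\<close>.\<close>

lemma exists_smooth_decomposition:
  fixes m :: nat
  assumes "m > 0"
  shows "\<exists>u m'. m = u * m' \<and> smooth_over S u \<and> (\<forall>p. prime p \<longrightarrow> p dvd m' \<longrightarrow> p \<notin> S)"
  using assms
proof (induction m rule: less_induct)
  case (less m)
  show ?case
  proof (cases "\<exists>p. prime p \<and> p dvd m \<and> p \<in> S")
    case True
    then obtain p k where p: "prime p" "p \<in> S" "m = p * k" by (auto elim: dvdE)
    have "k > 0" "k < m" using p less.prems prime_gt_1_nat[OF p(1)] by auto
    then obtain u m' where IH: "k = u * m'" "smooth_over S u" "\<forall>p. prime p \<longrightarrow> p dvd m' \<longrightarrow> p \<notin> S"
      using less.IH by blast
    have "smooth_over S p" using p by (auto simp: smooth_over_def prime_prime_factors prime_gt_0_nat)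
    then have "smooth_over S (p * u)" using IH(2) by (rule smooth_over_mult)
    moreover have "m = p * u * m'" using p(3) IH(1) by simp
    ultimately show ?thesis using IH(3) by blast
  next
    case False
    then show ?thesis by (intro exI[of _ 1] exI[of _ m]) auto
  qed
qed

lemma
  assumes "n > 0" "2 ^ n - 1 = u * m'" "smooth_over S u" "\<And>p. prime p \<Longrightarrow> p dvd m' \<Longrightarrow> p \<notin> S"
  shows card_fixed_points_TS: "card (fixed_points (dual_RS S) (TS S) n) = m'"
    and finite_fixed_points_TS: "finite (fixed_points (dual_RS S) (TS S) n)"
proof -
  have eq: "fixed_points (dual_RS S) (TS S) n =
      {f \<in> characters S. \<forall>r\<in>RS S. f (of_nat (2 ^ n - 1) * r) = 1}"
    using TS_funpow_fixed_iff by (auto simp: fixed_points_def topspace_dual_RS)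
  have "(2::nat) ^ n > 1" using assms(1) by (intro one_less_power) auto
  then have "m' > 0" using assms(2) by (cases m') auto
  then show "card (fixed_points (dual_RS S) (TS S) n) = m'" "finite (fixed_points (dual_RS S) (TS S) n)"
    unfolding eq using card_annihilator[OF assms(2) _ assms(3,4)] finite_annihilator[OF assms(2) _ assms(3,4)]
    by auto
qed

text \<open>The last two properties of the number of fixed points are what
  \<open>dvd_two_power_minus_1_le\<close> asks of its divisor.\<close>

lemma
  assumes "n > 0"
  shows fixed_points_TS_finite: "finite (fixed_points (dual_RS S) (TS S) n)"
    and card_fixed_points_TS_dvd: "card (fixed_points (dual_RS S) (TS S) n) dvd 2 ^ n - 1"
    and prime_dvd_card_fixed_points_TS: "prime p \<Longrightarrow> p dvd card (fixed_points (dual_RS S) (TS S) n) \<Longrightarrow> p \<notin> S"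
proof -
  have "(2::nat) ^ n - 1 > 0" using assms one_less_power[of "2::nat" n] by simp
  then obtain u m' where um: "2 ^ n - 1 = u * m'" "smooth_over S u" "\<forall>p. prime p \<longrightarrow> p dvd m' \<longrightarrow> p \<notin> S"
    using exists_smooth_decomposition by blast
  have c: "card (fixed_points (dual_RS S) (TS S) n) = m'" 
    and f: "finite (fixed_points (dual_RS S) (TS S) n)"
    using card_fixed_points_TS[OF assms um(1,2)] finite_fixed_points_TS[OF assms um(1,2)] um(3) by blast+
  show "finite (fixed_points (dual_RS S) (TS S) n)" by (rule f)
  show "card (fixed_points (dual_RS S) (TS S) n) dvd 2 ^ n - 1" unfolding c um(1) by simp
  show "prime p \<Longrightarrow> p dvd card (fixed_points (dual_RS S) (TS S) n) \<Longrightarrow> p \<notin> S"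
    unfolding c using um(3) by blast
qed

text \<open>Entropy ln 2 turns each exponential weight into a power of 1/2, and orbits of different
  lengths are different sets because the length is the cardinality.\<close>

lemma MS_eq:
  "MS S N = (\<Sum>n\<in>{1..N}. real (card (closed_orbits (dual_RS S) (TS S) n)) / 2 ^ n)"
proof -
  let ?C = "closed_orbits (dual_RS S) (TS S)"
  have fin: "finite (?C n)" for n
  proof (cases "n = 0")
    case False
    then show ?thesis
      using fixed_points_TS_finite TS_characters by (intro finite_closed_orbits) (auto simp: topspace_dual_RS)
  qed (simp add: closed_orbits_0)
  have disj: "?C i \<inter> ?C j = {}" if "i \<noteq> j" for i j
    using that closed_orbits_card by (metis disjoint_iff)
  have "MS S N = (\<Sum>\<tau>\<in>(\<Union>n\<in>{..N}. ?C n). 1 / 2 ^ card \<tau>)"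
    unfolding MS_def topological_entropy_TS
  proof (rule sum.cong)
    fix \<tau> :: "(rat \<Rightarrow> complex) set"
    have "exp (- real_of_ereal (ereal (ln 2)) * real (card \<tau>)) = exp (- (real (card \<tau>) * ln 2))"
      by (simp add: mult.commute)
    also have "\<dots> = 1 / 2 ^ card \<tau>"
      by (simp add: exp_minus exp_of_nat_mult field_simps)
    finally show "exp (- real_of_ereal (ereal (ln 2)) * real (card \<tau>)) = 1 / 2 ^ card \<tau>" .
  qed auto
  also have "\<dots> = (\<Sum>n\<in>{..N}. \<Sum>\<tau>\<in>?C n. 1 / 2 ^ card \<tau>)"
    using fin disj by (intro sum.UNION_disjoint) auto
  also have "\<dots> = (\<Sum>n\<in>{..N}. real (card (?C n)) / 2 ^ n)"
    by (intro sum.cong refl) (simp add: closed_orbits_card)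
  also have "\<dots> = (\<Sum>n\<in>{1..N}. real (card (?C n)) / 2 ^ n)"
    by (intro sum.mono_neutral_right) (auto simp: closed_orbits_0 not_less_eq_eq)
  finally show ?thesis .
qed

text \<open>For admissible n at most 2 * 2^(n/2) of the 2^n - 1 fixed points have a smaller period;
  the missing point raises the constant to 3. For other n, the factor n in the bound on fixed points
  cancels against the n points of each orbit.\<close>

lemma closed_orbits_approx:
  fixes P :: "nat set" and n :: nat
  defines "S \<equiv> excluded_primes P"
  assumes "n > 0"
  shows "\<bar>real (card (closed_orbits (dual_RS S) (TS S) n)) / 2 ^ n - (if n \<in> sqfree_over P then 1 / real n else 0)\<bar>
    \<le> 3 * 2 ^ (n div 2) / 2 ^ n"
proof -
  define c where "c = card (closed_orbits (dual_RS S) (TS S) n)"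
  define F where "F d = card (fixed_points (dual_RS S) (TS S) d)" for d
  have TX: "x \<in> topspace (dual_RS S) \<Longrightarrow> TS S x \<in> topspace (dual_RS S)" for x
    by (simp add: topspace_dual_RS TS_characters)
  have F_lt: "F d < 2 ^ d" if "d > 0" for d
  proof -
    have "(2::nat) ^ d > 1" using that by (intro one_less_power) auto
    moreover from this have "F d \<le> 2 ^ d - 1"
      using card_fixed_points_TS_dvd[OF that, of S] by (intro dvd_imp_le) (auto simp: F_def)
    ultimately show ?thesis by linarith
  qed
  have up: "n * c \<le> F n"
    unfolding c_def F_def using card_closed_orbits_le[OF assms(2) fixed_points_TS_finite TX] .
  have "F n \<le> n * c + (\<Sum>d\<in>{1..n div 2}. F d)"
    unfolding c_def F_def using card_closed_orbits_ge[OF assms(2) fixed_points_TS_finite TX] .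
  also have "(\<Sum>d\<in>{1..n div 2}. F d) \<le> (\<Sum>d\<in>{1..n div 2}. 2 ^ d)"
    using F_lt by (intro sum_mono) (auto simp: less_imp_le)
  also have "\<dots> \<le> (\<Sum>d<Suc (n div 2). 2 ^ d)"
    by (intro sum_mono2) auto
  also have "\<dots> \<le> 2 * 2 ^ (n div 2)"
    using mask_eq_sum_exp_nat[of "Suc (n div 2)"] by (simp add: lessThan_def)
  finally have low: "F n \<le> n * c + 2 * 2 ^ (n div 2)" by simp
  show ?thesis
  proof (cases "n \<in> sqfree_over P")
    case True
    have "F n = 2 ^ n - 1"
      unfolding F_def
    proof (rule card_fixed_points_TS[OF assms(2)])
      show "2 ^ n - 1 = 1 * (2 ^ n - 1 :: nat)" by simp
      show "p \<notin> S" if "prime p" "p dvd 2 ^ n - 1" for p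
        using excluded_primes_not_dvd[OF True] that unfolding S_def by blast
    qed simp
    moreover have "(1 :: nat) \<le> 2 ^ n" "(1 :: nat) \<le> 2 ^ (n div 2)" by simp_all
    ultimately have "2 ^ n \<le> n * c + 3 * 2 ^ (n div 2)" using low by linarith
    then have "real (2 ^ n) \<le> real (n * c + 3 * 2 ^ (n div 2))" by (simp only: of_nat_le_iff)
    then have l: "2 ^ n \<le> real n * real c + 3 * 2 ^ (n div 2)" by simp
    have "real (n * c) \<le> real (2 ^ n)" using up F_lt[OF assms(2)] by (simp only: of_nat_le_iff)
    then have u: "real n * real c \<le> 2 ^ n" by simp
    have "real c / 2 ^ n \<le> 1 / real n" using u assms(2) by (simp add: field_simps)
    moreover have "1 / real n - real c / 2 ^ n \<le> 3 * 2 ^ (n div 2) / 2 ^ n"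
    proof -
      have "1 / real n - real c / 2 ^ n = (2 ^ n - real n * real c) / (real n * 2 ^ n)"
        using assms(2) by (simp add: field_simps)
      also have "\<dots> \<le> (3 * 2 ^ (n div 2)) / (real n * 2 ^ n)"
        using l by (intro divide_right_mono) auto
      also have "\<dots> \<le> (3 * 2 ^ (n div 2)) / (1 * 2 ^ n)"
        using assms(2) by (intro divide_left_mono mult_right_mono) auto
      finally show ?thesis by simp
    qed
    ultimately show ?thesis using True by (simp add: c_def)
  next
    case False
    have "F n \<le> n * 2 ^ (n div 2)"
      using dvd_two_power_minus_1_le[OF assms(2) False] card_fixed_points_TS_dvd[OF assms(2)]
        prime_dvd_card_fixed_points_TS[OF assms(2)] unfolding F_def S_def by blast
    then have "n * c \<le> n * 2 ^ (n div 2)" using up by linarith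
    then have "c \<le> 2 ^ (n div 2)" using assms(2) by simp
    then have "real c \<le> 2 ^ (n div 2)" by (metis of_nat_le_iff of_nat_numeral of_nat_power)
    moreover have "(0 :: real) \<le> 2 ^ (n div 2)" by simp
    ultimately have "real c \<le> 3 * 2 ^ (n div 2)" by linarith
    then have "real c / 2 ^ n \<le> 3 * 2 ^ (n div 2) / 2 ^ n"
      by (intro divide_right_mono) auto
    then show ?thesis using False by (simp add: c_def)
  qed
qed

lemma summable_two_power_half: "summable (\<lambda>n. 3 * 2 ^ (n div 2) / 2 ^ n :: real)"
proof (rule summable_comparison_test'[where N = 0])
  have "sqrt 2 < 2" by (rule real_less_lsqrt) auto
  then show "summable (\<lambda>n. 3 * (sqrt 2 / 2) ^ n)"
    by (intro summable_mult summable_geometric) simp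
  fix n :: nat
  have "(2::real) ^ (n div 2) = sqrt 2 ^ (2 * (n div 2))" by (simp add: power_mult)
  also have "\<dots> \<le> sqrt 2 ^ n" by (intro power_increasing) auto
  finally show "norm (3 * 2 ^ (n div 2) / 2 ^ n :: real) \<le> 3 * (sqrt 2 / 2) ^ n"
    by (simp add: power_divide divide_right_mono)
qed

lemma MS_excluded_primes_bound:
  "\<exists>C. \<forall>N. \<bar>MS (excluded_primes P) N - (\<Sum>n\<in>sqfree_over P \<inter> {..N}. 1 / real n)\<bar> \<le> C"
proof (intro exI allI)
  fix N
  let ?S = "excluded_primes P"
  let ?e = "\<lambda>n. 3 * 2 ^ (n div 2) / 2 ^ n :: real"
  have "(\<Sum>n\<in>sqfree_over P \<inter> {..N}. 1 / real n) = (\<Sum>n\<in>{1..N}. if n \<in> sqfree_over P then 1 / real n else 0)"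
    by (rule sum.mono_neutral_cong_left) (auto simp: sqfree_over_def)
  then have "MS ?S N - (\<Sum>n\<in>sqfree_over P \<inter> {..N}. 1 / real n) =
     (\<Sum>n\<in>{1..N}. real (card (closed_orbits (dual_RS ?S) (TS ?S) n)) / 2 ^ n -
        (if n \<in> sqfree_over P then 1 / real n else 0))"
    by (simp add: MS_eq sum_subtractf)
  also have "\<bar>\<dots>\<bar> \<le> (\<Sum>n\<in>{1..N}. ?e n)"
    by (rule order.trans[OF sum_abs], intro sum_mono closed_orbits_approx) simp
  also have "\<dots> \<le> suminf ?e"
    by (intro sum_le_suminf summable_two_power_half) auto
  finally show "\<bar>MS ?S N - (\<Sum>n\<in>sqfree_over P \<inter> {..N}. 1 / real n)\<bar> \<le> suminf ?e" .
qed

lemma asymp_equiv_of_bounded_diff: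
  fixes f g :: "nat \<Rightarrow> real"
  assumes "\<And>n. \<bar>f n - g n\<bar> \<le> C" "filterlim g at_top sequentially"
  shows "f \<sim>[sequentially] g"
proof (rule asymp_equivI')
  have "(\<lambda>n. (f n - g n) / g n) \<longlonglongrightarrow> 0"
  proof (rule Lim_null_comparison)
    show "\<forall>\<^sub>F n in sequentially. norm ((f n - g n) / g n) \<le> C / \<bar>g n\<bar>"
      using assms(1) by (auto simp: abs_divide divide_right_mono)
    show "(\<lambda>n. C / \<bar>g n\<bar>) \<longlonglongrightarrow> 0"
      by (intro tendsto_divide_0[OF tendsto_const] filterlim_at_top_imp_at_infinity
          filterlim_compose[OF filterlim_abs_real assms(2)])
  qed
  then have "(\<lambda>n. 1 + (f n - g n) / g n) \<longlonglongrightarrow> 1 + 0" by (intro tendsto_add tendsto_const)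
  moreover have "\<forall>\<^sub>F n in sequentially. 1 + (f n - g n) / g n = f n / g n"
    using filterlim_at_top_dense[THEN iffD1, OF assms(2), rule_format, of 0]
    by eventually_elim (simp add: field_simps)
  ultimately show "(\<lambda>n. f n / g n) \<longlonglongrightarrow> 1" by (simp add: Lim_transform_eventually)
qed

theorem theorem5:
  fixes r :: nat and k :: real
  assumes "r \<ge> 1" and "k > 0"
  shows "\<exists>S. S \<subseteq> {p. prime p} \<and>
           MS S \<sim>[sequentially] (\<lambda>N. k * (ln (ln (real N))) ^ r)"
proof -
  obtain P where P: "(\<lambda>N. \<Sum>n\<in>sqfree_over P \<inter> {..N}. 1 / real n) \<sim>[sequentially] (\<lambda>N. k * ln (ln (real N)) ^ r)"
    using exists_sqfree_over_asymp[OF assms(2,1)] by blast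
  \<comment> \<open>Divergence of the main term, from r >= 1 and k > 0, makes the bounded error
    negligible.\<close>
  have "filterlim (\<lambda>N. ln (ln (real N)) ^ r) at_top sequentially"
    using assms(1) by (intro filterlim_pow_at_top) (simp, real_asymp)
  then have "filterlim (\<lambda>N. k * ln (ln (real N)) ^ r) at_top sequentially"
    using assms(2) by (intro filterlim_tendsto_pos_mult_at_top[OF tendsto_const])
  then have "filterlim (\<lambda>N. \<Sum>n\<in>sqfree_over P \<inter> {..N}. 1 / real n) at_top sequentially"
    by (rule asymp_equiv_at_top_transfer[OF asymp_equiv_symI[OF P]])
  moreover obtain C where "\<And>N. \<bar>MS (excluded_primes P) N - (\<Sum>n\<in>sqfree_over P \<inter> {..N}. 1 / real n)\<bar> \<le> C"
    using MS_excluded_primes_bound by blast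
  ultimately have "MS (excluded_primes P) \<sim>[sequentially] (\<lambda>N. \<Sum>n\<in>sqfree_over P \<inter> {..N}. 1 / real n)"
    by (intro asymp_equiv_of_bounded_diff)
  then have "MS (excluded_primes P) \<sim>[sequentially] (\<lambda>N. k * ln (ln (real N)) ^ r)"
    using P by (rule asymp_equiv_trans)
  moreover have "excluded_primes P \<subseteq> {p. prime p}" by (auto simp: excluded_primes_def)
  ultimately show ?thesis by blast
qed

end
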